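(* For an integer $n \ge 1$, let $\mathcal{G}_n$ be the $2$-by-$n$ grid graph, let $T_n$ be the number of spanning trees of $\mathcal{G}_n$, and let $S_n$ be the number of balanced spanning trees of $\mathcal{G}_n$. Then, with $m$ ranging over integers $m\ge 1$: \begin{enumerate} \item (Odd case) $\displaystyle \lim_{m\to\infty} \frac{S_{2m+1}}{T_{2m+1}} = \frac{3+\sqrt{3}}{9}$; \item (Even case) $\displaystyle \lim_{m\to\infty} \frac{S_{2m}}{T_{2m}} = \frac{1+4\sqrt{3}}{6\sqrt{3}}$. \end{enumerate}
   Context: The $2$-by-$n$ grid graph $\mathcal{G}_n$ has vertex set $\{1,2\}\times\{1,\dots,n\}$, with an edge between $(a,b)$ and $(a',b')$ exactly when $|a-a'|+|b-b'|=1$. A spanning tree $T$ of $\mathcal{G}_n$ is called balanced if it contains an edge whose removal partitions the vertex set of $\mathcal{G}_n$ into two sets of equal size (the vertex sets of the two components of $T$ minus that edge). Thus $S_n/T_n$ is the probability that a uniformly random spanning tree of $\mathcal{G}_n$ is balanced. *)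

theory Defs
  imports Complex_Main
begin

text \<open>
  An undirected simple graph is given by a vertex set \<open>V\<close> and a set \<open>E\<close> of two-element
  subsets of \<open>V\<close>.  The trees of the AFP entry \<open>Graph_Theory\<close> are not used:
  they forbid only directed cycles, so there a symmetric digraph with an edge is never
  a tree, whereas an acyclically oriented triangle is one.
\<close>

definition edge_rel :: "'a set set \<Rightarrow> ('a \<times> 'a) set" where
  "edge_rel E = {(u, v). {u, v} \<in> E}"

definition graph_connected :: "'a set \<Rightarrow> 'a set set \<Rightarrow> bool" where
  "graph_connected V E \<longleftrightarrow> V \<noteq> {} \<and> (\<forall>u\<in>V. \<forall>v\<in>V. (u, v) \<in> (edge_rel E)\<^sup>*)"

definition graph_cycle :: "'a set set \<Rightarrow> 'a list \<Rightarrow> bool" where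
  "graph_cycle E p \<longleftrightarrow> length p \<ge> 3 \<and> distinct p \<and>
     (\<forall>i < length p. {p ! i, p ! (Suc i mod length p)} \<in> E)"

definition graph_tree :: "'a set \<Rightarrow> 'a set set \<Rightarrow> bool" where
  "graph_tree V E \<longleftrightarrow> graph_connected V E \<and> (\<nexists>p. graph_cycle E p)"

definition components_verts :: "'a set \<Rightarrow> 'a set set \<Rightarrow> 'a set set" where
  "components_verts V E = V // {(u, v). u \<in> V \<and> v \<in> V \<and> (u, v) \<in> (edge_rel E)\<^sup>*}"

text \<open>A spanning tree of \<open>(V, E)\<close> has vertex set \<open>V\<close>, so it is identified with its edge set.\<close>

definition spanning_trees :: "'a set \<Rightarrow> 'a set set \<Rightarrow> 'a set set set" where
  "spanning_trees V E = {T. T \<subseteq> E \<and> graph_tree V T}"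

definition balanced_tree :: "'a set \<Rightarrow> 'a set set \<Rightarrow> bool" where
  "balanced_tree V T \<longleftrightarrow>
     (\<exists>e\<in>T. \<exists>A B. components_verts V (T - {e}) = {A, B} \<and> A \<noteq> B \<and> card A = card B)"

definition grid_verts :: "nat \<Rightarrow> (int \<times> int) set" where
  "grid_verts n = {1, 2} \<times> {1..int n}"

definition grid_edges :: "nat \<Rightarrow> (int \<times> int) set set" where
  "grid_edges n = {{(a, b), (a', b')} | a b a' b'.
     (a, b) \<in> grid_verts n \<and> (a', b') \<in> grid_verts n \<and> \<bar>a - a'\<bar> + \<bar>b - b'\<bar> = 1}"

definition num_spanning_trees :: "nat \<Rightarrow> nat" where
  "num_spanning_trees n = card (spanning_trees (grid_verts n) (grid_edges n))"

definition num_balanced_spanning_trees :: "nat \<Rightarrow> nat" where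
  "num_balanced_spanning_trees n =
     card {T \<in> spanning_trees (grid_verts n) (grid_edges n). balanced_tree (grid_verts n) T}"

end

theory Submission
  imports Defs
begin

text \<open>
  A spanning tree is balanced iff some vertex set \<open>C\<close> of half the size is crossed by exactly one
  tree edge, and then both sides of the cut are subtrees.  The part of such a cut containing the
  corner \<open>(1, 1)\<close> can only consist of the first \<open>p\<close> full columns followed by a piece
  of one row reaching column \<open>n - p\<close>.  Both sides are thus 2-by-\<open>p\<close> grids with a pendant
  path, so each has \<open>T\<^sub>p\<close> spanning trees (one if \<open>p = 0\<close>), and there are
  \<open>n - 2 p + 2\<close> crossing edges (\<open>n\<close> if \<open>p = 0\<close>).  Summing over the shapes gives
  \<open>S\<^sub>n = n + \<Sum> w\<^sub>p (n - 2 p + 2) T\<^sub>p\<^sup>2\<close> over \<open>1 \<le> p \<le> n / 2\<close>, where \<open>w\<^sub>p = 2\<close> except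
  that \<open>w\<^sub>p = 1\<close> for \<open>p = n / 2\<close>.  Finally
  \<open>T\<^sub>n\<^sub>+\<^sub>2 = 4 T\<^sub>n\<^sub>+\<^sub>1 - T\<^sub>n\<close> makes all sums explicit.
\<close>

section \<open>Cuts and trees\<close>

text \<open>The shapes can be added without overlap because a tree has at most one half that
  contains the corner and is crossed once: the crossing edge of a second half cannot lie inside both
  sides of the first. The shape is rigid because both sides are connected and equally large: past
  the full columns neither side can stop before column \<open>n - p\<close>, and in a strip of
  height two each is then confined to its own row. The recurrence comes from the last rung:
  replacing it by a three-edge detour through a new rung matches the trees using all three new edges
  with the old trees containing the rung, while the old trees avoiding it are counted by the ladder
  one column shorter. The limits are nontrivial because T_p^2 grows like (2 + sqrt 3)^(2p), the same
  rate as T_(2p): the sum over \<open>p\<close> behaves like a geometric one, and its terms with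
  \<open>p\<close> close to \<open>n / 2\<close>, weighted by the number of crossing edges, make up
  a fixed proportion of T_n.\<close>

definition simple_graph :: "'a set \<Rightarrow> 'a set set \<Rightarrow> bool" where
  "simple_graph V E \<longleftrightarrow> (\<forall>e\<in>E. \<exists>u\<in>V. \<exists>v\<in>V. u \<noteq> v \<and> e = {u, v})"

text \<open>Neither this nor \<open>induced\<close> refers to an ambient vertex set: a crossing edge
  meets \<open>C\<close> without lying inside it. On a simple graph this means one end on each
  side.\<close>

definition cut :: "'a set set \<Rightarrow> 'a set \<Rightarrow> 'a set set" where
  "cut E C = {e \<in> E. e \<inter> C \<noteq> {} \<and> \<not> e \<subseteq> C}"

definition induced :: "'a set set \<Rightarrow> 'a set \<Rightarrow> 'a set set" where
  "induced E C = {e \<in> E. e \<subseteq> C}"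

lemma simple_graphE:
  assumes "simple_graph V E" "e \<in> E"
  obtains u v where "u \<in> V" "v \<in> V" "u \<noteq> v" "e = {u, v}"
  using assms unfolding simple_graph_def by blast

lemma simple_graph_subset: "simple_graph V E \<Longrightarrow> F \<subseteq> E \<Longrightarrow> simple_graph V F"
  unfolding simple_graph_def by blast

lemma simple_graph_edgeD: "simple_graph V E \<Longrightarrow> {x, y} \<in> E \<Longrightarrow> x \<in> V \<and> y \<in> V \<and> x \<noteq> y"
  unfolding simple_graph_def by (metis doubleton_eq_iff)

lemma simple_graph_induced: "simple_graph V E \<Longrightarrow> simple_graph C (induced E C)"
  by (fastforce simp: simple_graph_def induced_def)

lemma edge_rel_iff [simp]: "(x, y) \<in> edge_rel E \<longleftrightarrow> {x, y} \<in> E"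
  by (simp add: edge_rel_def)

lemma edge_rel_rtrancl_sym: "(x, y) \<in> (edge_rel E)\<^sup>* \<Longrightarrow> (y, x) \<in> (edge_rel E)\<^sup>*"
proof -
  have "sym (edge_rel E)" by (auto simp: sym_def insert_commute)
  then show "(x, y) \<in> (edge_rel E)\<^sup>* \<Longrightarrow> (y, x) \<in> (edge_rel E)\<^sup>*"
    by (meson sym_rtrancl symD)
qed

lemma edge_rel_rtrancl_mono: "E \<subseteq> F \<Longrightarrow> (x, y) \<in> (edge_rel E)\<^sup>* \<Longrightarrow> (x, y) \<in> (edge_rel F)\<^sup>*"
  by (rule subsetD[OF rtrancl_mono]) auto

lemma graph_connectedI:
  assumes "u \<in> V" "\<And>x. x \<in> V \<Longrightarrow> (u, x) \<in> (edge_rel E)\<^sup>*"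
  shows "graph_connected V E"
  unfolding graph_connected_def
proof (intro conjI ballI)
  show "V \<noteq> {}" using assms(1) by blast
  fix x y assume "x \<in> V" "y \<in> V"
  then show "(x, y) \<in> (edge_rel E)\<^sup>*"
    using assms(2) edge_rel_rtrancl_sym rtrancl_trans by metis
qed

lemma graph_cycle_mono: "graph_cycle E p \<Longrightarrow> E \<subseteq> F \<Longrightarrow> graph_cycle F p"
  unfolding graph_cycle_def by blast

lemma rtrancl_closed:
  assumes "(x, y) \<in> (edge_rel E)\<^sup>*" "x \<in> C" "cut E C = {}"
  shows "y \<in> C"
  using assms(1)
proof induction
  case base show ?case by (rule assms(2))
next
  case (step y z)
  then have "{y, z} \<in> E" by simp
  then show ?case using assms(3) \<open>y \<in> C\<close> unfolding cut_def by blast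
qed

lemma graph_connected_cut_nonempty:
  assumes "graph_connected V T" "x \<in> V" "x \<in> C" "y \<in> V" "y \<notin> C"
  shows "cut T C \<noteq> {}"
  using assms rtrancl_closed[of x y T C] unfolding graph_connected_def by blast

text \<open>A walk can leave and re-enter \<open>C\<close> only through \<open>u\<close>, so each
  excursion outside is a round trip from \<open>u\<close> to \<open>u\<close> and can be cut
  out.\<close>

lemma induced_rtrancl:
  assumes "(x, y) \<in> (edge_rel F)\<^sup>*" "x \<in> C" "y \<in> C" "cut F C \<subseteq> {{u, v}}" "v \<notin> C"
  shows "(x, y) \<in> (edge_rel (induced F C))\<^sup>*"
proof -
  let ?R = "(edge_rel (induced F C))\<^sup>*"
  \<comment> \<open>The induction invariant: while the walk is outside \<open>C\<close>, what is
    remembered is that \<open>u\<close>, its exit point, is reachable inside.\<close>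
  have "(y \<in> C \<longrightarrow> (x, y) \<in> ?R) \<and> (y \<notin> C \<longrightarrow> (x, u) \<in> ?R)"
    using assms(1)
  proof induction
    case base then show ?case using assms(2) by simp
  next
    case (step y z)
    then have e: "{y, z} \<in> F" by simp
    consider "y \<in> C" "z \<in> C" | "y \<in> C" "z \<notin> C" | "y \<notin> C" "z \<in> C" | "y \<notin> C" "z \<notin> C" by blast
    then show ?case
    proof cases
      case 1
      then have "(y, z) \<in> edge_rel (induced F C)" using e by (simp add: induced_def)
      then show ?thesis using 1 step.IH by (meson rtrancl.rtrancl_into_rtrancl)
    next
      case 2
      then have "{y, z} \<in> cut F C" using e by (simp add: cut_def)
      then have "{y, z} = {u, v}" using assms(4) by blast
      then show ?thesis using 2 assms(5) step.IH by (metis doubleton_eq_iff)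
    next
      case 3
      then have "{y, z} \<in> cut F C" using e by (auto simp: cut_def)
      then have "{y, z} = {u, v}" using assms(4) by blast
      then show ?thesis using 3 assms(5) step.IH by (metis doubleton_eq_iff)
    next
      case 4 then show ?thesis using step.IH by blast
    qed
  qed
  then show ?thesis using assms(3) by blast
qed

lemma cut_Diff:
  assumes "simple_graph V E"
  shows "cut E (V - C) = cut E C"
proof -
  have "e \<inter> (V - C) \<noteq> {} \<and> \<not> e \<subseteq> V - C \<longleftrightarrow> e \<inter> C \<noteq> {} \<and> \<not> e \<subseteq> C" if "e \<in> E" for e
    using simple_graphE[OF assms that] by auto
  then show ?thesis by (auto simp: cut_def)
qed

lemma graph_connected_induced:
  assumes "graph_connected V T" "C \<subseteq> V" "cut T C \<subseteq> {{u, v}}" "v \<notin> C" "C \<noteq> {}"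
  shows "graph_connected C (induced T C)"
  unfolding graph_connected_def
proof (intro conjI ballI)
  fix x y assume "x \<in> C" "y \<in> C"
  moreover have "(x, y) \<in> (edge_rel T)\<^sup>*"
    using assms(1,2) \<open>x \<in> C\<close> \<open>y \<in> C\<close> unfolding graph_connected_def by blast
  ultimately show "(x, y) \<in> (edge_rel (induced T C))\<^sup>*"
    using induced_rtrancl assms(3,4) by metis
qed (rule assms(5))

lemma cycle_through_cut:
  assumes "graph_cycle T p" "i < length p" "p ! i \<in> C" "j < length p" "p ! j \<notin> C"
  shows "\<exists>k < length p. p ! k \<in> C \<and> p ! (Suc k mod length p) \<notin> C"
proof (rule ccontr)
  assume *: "\<not> ?thesis"
  let ?L = "length p"
  have L: "?L > 0" using assms(2) by linarith
  have "p ! ((i + k) mod ?L) \<in> C" for k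
  proof (induction k)
    case 0 then show ?case using assms by simp
  next
    case (Suc k)
    have "(i + k) mod ?L < ?L" using L by simp
    then have "p ! (Suc ((i + k) mod ?L) mod ?L) \<in> C" using * Suc by blast
    then show ?case by (simp add: mod_Suc_eq)
  qed
  \<comment> \<open>Going round from \<open>i\<close> by this many steps ends at \<open>j\<close>;
    the summand \<open>?L\<close> keeps the subtraction from being truncated.\<close>
  from this[of "?L + j - i"] show False using assms by simp
qed

text \<open>With a single crossing edge, connections within a side never need the other side, and no
  cycle can use both sides, since it would have to cross once outwards and once inwards over the
  same edge. All later counting rests on this equivalence.\<close>

lemma tree_split:
  assumes "simple_graph V T" "C \<subseteq> V" "cut T C = {{u, v}}" "u \<in> C" "v \<notin> C"
  shows "graph_tree V T \<longleftrightarrow> graph_tree C (induced T C) \<and> graph_tree (V - C) (induced T (V - C))"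
proof
  have uv: "{u, v} \<in> T" using assms(3) by (auto simp: cut_def)
  then have V: "u \<in> V" "v \<in> V" using assms(1) simple_graph_edgeD by metis+
  have cut': "cut T (V - C) = {{v, u}}" using assms(1,3) cut_Diff by (metis insert_commute)
  {
    assume T: "graph_tree V T"
    then have con: "graph_connected V T" by (simp add: graph_tree_def)
    have "graph_connected C (induced T C)"
      using graph_connected_induced[OF con assms(2), of u v] assms(3,4,5) by auto
    moreover have "graph_connected (V - C) (induced T (V - C))"
      using graph_connected_induced[OF con, of "V - C" v u] cut' assms(4,5) V by auto
    ultimately show "graph_tree C (induced T C) \<and> graph_tree (V - C) (induced T (V - C))"
      using T graph_cycle_mono[of _ _ T] unfolding graph_tree_def induced_def by blast
  }
  assume T: "graph_tree C (induced T C) \<and> graph_tree (V - C) (induced T (V - C))"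
  have sub: "induced T W \<subseteq> T" for W by (auto simp: induced_def)
  show "graph_tree V T"
    unfolding graph_tree_def
  proof
    show "graph_connected V T"
    proof (rule graph_connectedI[OF V(1)])
      fix x assume x: "x \<in> V"
      show "(u, x) \<in> (edge_rel T)\<^sup>*"
      proof (cases "x \<in> C")
        case True
        then have "(u, x) \<in> (edge_rel (induced T C))\<^sup>*"
          using T assms(4) unfolding graph_tree_def graph_connected_def by blast
        then show ?thesis by (rule edge_rel_rtrancl_mono[OF sub])
      next
        case False
        then have "(v, x) \<in> (edge_rel (induced T (V - C)))\<^sup>*"
          using T assms(5) V x unfolding graph_tree_def graph_connected_def by blast
        then have "(v, x) \<in> (edge_rel T)\<^sup>*" by (rule edge_rel_rtrancl_mono[OF sub])
        moreover have "(u, v) \<in> edge_rel T" using uv by simp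
        ultimately show ?thesis by (rule converse_rtrancl_into_rtrancl[rotated])
      qed
    qed
    show "\<nexists>p. graph_cycle T p"
    proof
      assume "\<exists>p. graph_cycle T p"
      then obtain p where p: "graph_cycle T p" ..
      let ?L = "length p"
      from p have L: "?L \<ge> 3" and dist: "distinct p"
        and E: "\<And>i. i < ?L \<Longrightarrow> {p ! i, p ! (Suc i mod ?L)} \<in> T"
        unfolding graph_cycle_def by auto
      have modL: "Suc i mod ?L < ?L" for i using L by (intro mod_less_divisor) linarith
      have inV: "p ! i \<in> V" if "i < ?L" for i
        using E[OF that] assms(1) simple_graph_edgeD by metis
      consider "\<forall>i<?L. p ! i \<in> C" | "\<forall>i<?L. p ! i \<notin> C"
        | i j where "i < ?L" "p ! i \<in> C" "j < ?L" "p ! j \<notin> C" by blast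
      then show False
      proof cases
        case 1
        then have "graph_cycle (induced T C) p"
          using p modL unfolding graph_cycle_def induced_def by simp
        then show False using T by (auto simp: graph_tree_def)
      next
        case 2
        then have "graph_cycle (induced T (V - C)) p"
          using p modL inV unfolding graph_cycle_def induced_def by simp
        then show False using T by (auto simp: graph_tree_def)
      next
        \<comment> \<open>The outward step at \<open>k\<close> and the inward step at
          \<open>l\<close> both run along \<open>{u, v}\<close>. Distinctness of the vertices makes
          \<open>k\<close> and \<open>l\<close> cyclic successors of each other, which forces length
          2.\<close>
        case 3
        obtain k where k: "k < ?L" "p ! k \<in> C" "p ! (Suc k mod ?L) \<notin> C"
          using cycle_through_cut[OF p 3] by blast
        obtain l where l: "l < ?L" "p ! l \<notin> C" "p ! (Suc l mod ?L) \<in> C"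
          using cycle_through_cut[OF p, of j "- C" i] 3 by auto
        have "{p ! k, p ! (Suc k mod ?L)} \<in> cut T C" using E[OF k(1)] k by (auto simp: cut_def)
        then have a: "p ! k = u" "p ! (Suc k mod ?L) = v"
          using assms k by (auto simp: doubleton_eq_iff)
        have "{p ! l, p ! (Suc l mod ?L)} \<in> cut T C" using E[OF l(1)] l by (auto simp: cut_def)
        then have b: "p ! l = v" "p ! (Suc l mod ?L) = u"
          using assms l by (auto simp: doubleton_eq_iff)
        have "k = Suc l mod ?L" "l = Suc k mod ?L"
          using a b dist k(1) l(1) modL by (metis nth_eq_iff_index_eq)+
        moreover have "Suc i mod ?L = (if Suc i = ?L then 0 else Suc i)" if "i < ?L" for i
          using that by (auto simp: mod_Suc)
        ultimately have "Suc l = ?L \<and> k = 0 \<or> k = Suc l" "Suc k = ?L \<and> l = 0 \<or> l = Suc k"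
          using k(1) l(1) by metis+
        then show False using L by arith
      qed
    qed
  qed
qed

text \<open>When the next vertex already occurs on the path, the path is truncated there. Distinct
  vertices are required because \<open>graph_cycle\<close> asks for them.\<close>

lemma rtrancl_distinct_path:
  assumes "(x, y) \<in> (edge_rel E)\<^sup>*"
  shows "\<exists>p. p \<noteq> [] \<and> hd p = x \<and> last p = y \<and> distinct p \<and> (\<forall>i. Suc i < length p \<longrightarrow> {p ! i, p ! Suc i} \<in> E)"
  using assms
proof induction
  case base
  show ?case by (rule exI[of _ "[x]"]) simp
next
  case (step y z)
  then obtain p where p: "p \<noteq> []" "hd p = x" "last p = y" "distinct p"
    "\<forall>i. Suc i < length p \<longrightarrow> {p ! i, p ! Suc i} \<in> E" by blast
  show ?case
  proof (cases "z \<in> set p")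
    case True
    then obtain k where k: "k < length p" "p ! k = z" by (metis in_set_conv_nth)
    let ?q = "take (Suc k) p"
    have "?q \<noteq> []" "hd ?q = x" "distinct ?q" using p k by auto
    moreover have "last ?q = z" using k by (simp add: take_Suc_conv_app_nth)
    moreover have "\<forall>i. Suc i < length ?q \<longrightarrow> {?q ! i, ?q ! Suc i} \<in> E" using p k by simp
    ultimately show ?thesis by blast
  next
    case False
    let ?q = "p @ [z]"
    have "{?q ! i, ?q ! Suc i} \<in> E" if "Suc i < length ?q" for i
    proof (cases "Suc i < length p")
      case True then show ?thesis using p by (simp add: nth_append)
    next
      case False
      then have "i = length p - 1" using that p by simp
      then have "?q ! i = y" "?q ! Suc i = z"
        using p by (auto simp: nth_append last_conv_nth)
      then show ?thesis using step by simp
    qed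
    then show ?thesis using p False by (intro exI[of _ ?q]) auto
  qed
qed

text \<open>A path from \<open>u\<close> to \<open>v\<close> avoiding the edge would close up with
  it to a cycle. Its length is at least 3, since a path on two vertices would be the deleted edge
  itself.\<close>

lemma tree_edge_bridge:
  assumes "graph_tree V T" "{u, v} \<in> T" "u \<noteq> v"
  shows "(u, v) \<notin> (edge_rel (T - {{u, v}}))\<^sup>*"
proof
  assume "(u, v) \<in> (edge_rel (T - {{u, v}}))\<^sup>*"
  from rtrancl_distinct_path[OF this] obtain p where p: "p \<noteq> []" "hd p = u" "last p = v" "distinct p"
    "\<And>i. Suc i < length p \<Longrightarrow> {p ! i, p ! Suc i} \<in> T - {{u, v}}" by blast
  have 0: "p ! 0 = u" "p ! (length p - 1) = v" using p by (auto simp: hd_conv_nth last_conv_nth)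
  have "length p \<noteq> 0" using p by simp
  moreover have "length p \<noteq> 1" using 0 assms(3) by auto
  moreover have "length p \<noteq> 2" using 0 p(5)[of 0] by auto
  ultimately have L: "length p \<ge> 3" by linarith
  have "{p ! i, p ! (Suc i mod length p)} \<in> T" if "i < length p" for i
  proof (cases "Suc i < length p")
    case True then show ?thesis using p(5) by simp
  next
    case False
    then have "i = length p - 1" "Suc i mod length p = 0" using that by (auto simp: mod_Suc)
    then show ?thesis using 0 assms(2) by (simp add: insert_commute)
  qed
  then have "graph_cycle T p" using L p(4) by (simp add: graph_cycle_def)
  then show False using assms(1) by (auto simp: graph_tree_def)
qed

text \<open>The set is the component of \<open>u\<close> after deletion of the edge; any other edge
  leaving it would enlarge it.\<close>

lemma tree_edge_cut:
  assumes "simple_graph V T" "graph_tree V T" "{u, v} \<in> T"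
  obtains C where "C \<subseteq> V" "u \<in> C" "v \<notin> C" "cut T C = {{u, v}}"
proof
  let ?R = "(edge_rel (T - {{u, v}}))\<^sup>*"
  let ?C = "{x \<in> V. (u, x) \<in> ?R}"
  note uv = simple_graph_edgeD[OF assms(1,3)]
  show "?C \<subseteq> V" "u \<in> ?C" using uv by auto
  show v: "v \<notin> ?C" using tree_edge_bridge[OF assms(2,3)] uv by simp
  have "e = {u, v}" if e: "e \<in> T" "e \<inter> ?C \<noteq> {}" "\<not> e \<subseteq> ?C" for e
  proof (rule ccontr)
    assume ne: "e \<noteq> {u, v}"
    obtain x y where xy: "e = {x, y}" "x \<in> ?C" "y \<notin> ?C" "y \<in> V"
      using e assms(1) by (elim simple_graphE) auto
    then have "(x, y) \<in> edge_rel (T - {{u, v}})" using e ne by auto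
    then have "(u, y) \<in> ?R" using xy by (metis (no_types, lifting) mem_Collect_eq rtrancl.rtrancl_into_rtrancl)
    then show False using xy by blast
  qed
  then show "cut T ?C = {{u, v}}" using assms(3) \<open>u \<in> ?C\<close> v unfolding cut_def by blast
qed

lemma cut_singletonE:
  assumes "simple_graph V T" "cut T C = {e}"
  obtains u v where "u \<in> V" "v \<in> V" "u \<in> C" "v \<notin> C" "e = {u, v}"
proof -
  have e: "e \<in> T" "e \<inter> C \<noteq> {}" "\<not> e \<subseteq> C" using assms(2) by (auto simp: cut_def)
  then obtain x y where "x \<in> V" "y \<in> V" "e = {x, y}" using assms(1) by (elim simple_graphE)
  then show thesis using e that by (cases "x \<in> C") auto
qed

text \<open>Replaces the quotient in \<open>components_verts\<close> by cuts. Only the deleted edge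
  can leave a class, and connectedness of \<open>T\<close> says that some edge does; conversely
  \<open>tree_split\<close> keeps both sides of the cut connected without \<open>e\<close>, so they
  are exactly the two classes.\<close>

lemma balanced_tree_iff_cut:
  assumes "finite V" "simple_graph V T" "graph_tree V T"
  shows "balanced_tree V T \<longleftrightarrow> (\<exists>C\<subseteq>V. 2 * card C = card V \<and> (\<exists>e. cut T C = {e}))"
proof
  assume "balanced_tree V T"
  then obtain e A B where e: "e \<in> T" "components_verts V (T - {e}) = {A, B}" "A \<noteq> B" "card A = card B"
    unfolding balanced_tree_def by blast
  let ?r = "{(u, v). u \<in> V \<and> v \<in> V \<and> (u, v) \<in> (edge_rel (T - {e}))\<^sup>*}"
  have eq: "equiv V ?r"
    by (rule equivI) (auto simp: refl_on_def sym_def trans_def intro: edge_rel_rtrancl_sym)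
  have q: "V // ?r = {A, B}" using e(2) by (simp add: components_verts_def)
  have U: "A \<union> B = V" using Union_quotient[OF eq] q by simp
  have "A \<inter> B = {}" using quotient_disj[OF eq, of A B] q e(3) by blast
  then have c: "2 * card A = card V"
    using U assms(1) e(4) card_Un_disjoint[of A B] by (metis finite_Un mult_2)
  have ne: "A \<noteq> {}" "B \<noteq> {}" using in_quotient_imp_non_empty[OF eq] q by blast+
  have "f = e" if f: "f \<in> cut T A" for f
  proof (rule ccontr)
    assume "f \<noteq> e"
    have "f \<in> T" "f \<inter> A \<noteq> {}" "\<not> f \<subseteq> A" using f by (auto simp: cut_def)
    then obtain x y where xy: "f = {x, y}" "x \<in> A" "y \<notin> A" "x \<in> V" "y \<in> V"
      using assms(2) by (elim simple_graphE) auto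
    then have "(x, y) \<in> ?r" using \<open>f \<in> T\<close> \<open>f \<noteq> e\<close> by auto
    then have "y \<in> A" using in_quotient_imp_closed[OF eq, of A x y] q xy by simp
    then show False using xy by simp
  qed
  moreover obtain x y where "x \<in> V" "x \<in> A" "y \<in> V" "y \<notin> A" using ne U \<open>A \<inter> B = {}\<close> by blast
  then have "cut T A \<noteq> {}" using graph_connected_cut_nonempty assms(3) unfolding graph_tree_def by metis
  ultimately have "cut T A = {e}" by blast
  then show "\<exists>C\<subseteq>V. 2 * card C = card V \<and> (\<exists>e. cut T C = {e})" using U c by blast
next
  assume "\<exists>C\<subseteq>V. 2 * card C = card V \<and> (\<exists>e. cut T C = {e})"
  then obtain C e where C: "C \<subseteq> V" "2 * card C = card V" "cut T C = {e}" by blast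
  then obtain u v where uv: "u \<in> V" "v \<in> V" "u \<in> C" "v \<notin> C" "e = {u, v}"
    using assms(2) by (elim cut_singletonE)
  have e: "e \<in> T" using C(3) by (auto simp: cut_def)
  let ?S = "(edge_rel (T - {e}))\<^sup>*"
  let ?r = "{(u, v). u \<in> V \<and> v \<in> V \<and> (u, v) \<in> ?S}"
  have tr: "graph_tree C (induced T C)" "graph_tree (V - C) (induced T (V - C))"
    using tree_split[OF assms(2) C(1)] C(3) uv assms(3) by auto
  have "induced T C \<subseteq> T - {e}" "induced T (V - C) \<subseteq> T - {e}" using uv by (auto simp: induced_def)
  then have con: "(x, y) \<in> ?S" if "x \<in> C \<and> y \<in> C \<or> x \<in> V - C \<and> y \<in> V - C" for x y
    using tr that edge_rel_rtrancl_mono unfolding graph_tree_def graph_connected_def by metis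
  have c0: "cut (T - {e}) C = {}" using C(3) by (auto simp: cut_def)
  have sep: "(x, y) \<notin> ?S" if "x \<in> C" "y \<notin> C" for x y
    using rtrancl_closed[OF _ that(1) c0] that(2) by metis
  then have sep': "(y, x) \<notin> ?S" if "x \<in> C" "y \<notin> C" for x y
    using that edge_rel_rtrancl_sym by metis
  have "(x, y) \<in> ?S \<longleftrightarrow> (x \<in> C \<longleftrightarrow> y \<in> C)" if "x \<in> V" "y \<in> V" for x y
    using con[of x y] sep[of x y] sep'[of y x] that by blast
  then have cl: "?r `` {x} = (if x \<in> C then C else V - C)" if "x \<in> V" for x
    using C(1) that by auto
  have "V // ?r = (\<lambda>x. if x \<in> C then C else V - C) ` V"
    unfolding quotient_def using cl by auto
  also have "\<dots> = {C, V - C}" using uv by auto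
  finally have "components_verts V (T - {e}) = {C, V - C}" by (simp add: components_verts_def)
  moreover have "card C = card (V - C)"
    using C assms(1) by (simp add: card_Diff_subset finite_subset)
  moreover have "C \<noteq> V - C" using uv by blast
  ultimately show "balanced_tree V T" unfolding balanced_tree_def using e by blast
qed

section \<open>Counting trees with a single cut edge\<close>

lemma simple_graph_insert:
  "simple_graph V (insert {u, v} F) \<longleftrightarrow> u \<in> V \<and> v \<in> V \<and> u \<noteq> v \<and> simple_graph V F"
proof
  assume s: "simple_graph V (insert {u, v} F)"
  then have "simple_graph V F" by (rule simple_graph_subset) blast
  then show "u \<in> V \<and> v \<in> V \<and> u \<noteq> v \<and> simple_graph V F"
    using simple_graph_edgeD[OF s, of u v] by blast
qed (auto simp: simple_graph_def)

lemma simple_graph_mono: "simple_graph V F \<Longrightarrow> V \<subseteq> W \<Longrightarrow> simple_graph W F"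
  unfolding simple_graph_def by (meson subsetD)

text \<open>The edge \<open>e'\<close> cannot lie inside both \<open>C\<close> and
  \<open>V - C\<close>, so one of these connected sides is not crossed by \<open>C'\<close> and is
  contained in it or disjoint from it. As all the sets have half the size, \<open>C'\<close> is
  \<open>C\<close> or \<open>V - C\<close>, and \<open>x\<close> rules out the latter. This makes
  the families of trees for different shapes disjoint.\<close>

lemma tree_card_cut_unique:
  assumes "finite V" "simple_graph V T" "graph_tree V T"
    and "C \<subseteq> V" "cut T C = {e}" "C' \<subseteq> V" "cut T C' = {e'}"
    and "x \<in> C" "x \<in> C'" "card C = card C'" "2 * card C = card V"
  shows "C = C'"
proof -
  obtain u v where uv: "u \<in> V" "v \<in> V" "u \<in> C" "v \<notin> C" "e = {u, v}"
    using assms(2,5) by (elim cut_singletonE)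
  have fin: "finite C" "finite C'" using finite_subset[OF assms(4,1)] finite_subset[OF assms(6,1)] by auto
  have cD: "card (V - C) = card C'" using assms(4,10,11) fin by (simp add: card_Diff_subset)
  have con: "graph_connected C (induced T C)" "graph_connected (V - C) (induced T (V - C))"
    using tree_split[OF assms(2,4)] assms(3,5) uv by (auto simp: graph_tree_def)
  have "e' \<in> cut T C'" using assms(7) by simp
  then have e'_ne: "e' \<noteq> {}" by (auto simp: cut_def)
  have cut0: "cut (induced T W) C' = {}" if "\<not> e' \<subseteq> W" for W
  proof -
    have "f = e' \<and> f \<subseteq> W" if "f \<in> cut (induced T W) C'" for f
    proof -
      have "f \<in> cut T C'" "f \<subseteq> W" using that unfolding cut_def induced_def by blast+
      then show ?thesis using assms(7) by simp
    qed
    then show ?thesis using that by blast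
  qed
  show ?thesis
  proof (cases "e' \<subseteq> C")
    case False
    then have "cut (induced T C) C' = {}" by (rule cut0)
    then have "C \<subseteq> C'"
      using graph_connected_cut_nonempty[OF con(1) assms(8,9)] by blast
    then show ?thesis using assms(10) fin by (metis card_subset_eq)
  next
    case True
    then have "\<not> e' \<subseteq> V - C" using e'_ne by blast
    then have 0: "cut (induced T (V - C)) C' = {}" by (rule cut0)
    show ?thesis
    proof (cases "(V - C) \<inter> C' = {}")
      case True
      then have "C' \<subseteq> C" using assms(6) by blast
      then show ?thesis using assms(10) fin by (metis card_subset_eq)
    next
      case False
      then have "V - C \<subseteq> C'"
        using graph_connected_cut_nonempty[OF con(2)] 0 by blast
      then have "V - C = C'" using cD fin by (metis card_subset_eq)
      then show ?thesis using assms(8,9) by blast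
    qed
  qed
qed

text \<open>By \<open>tree_split\<close> the two side trees and the crossing edge can be chosen
  independently, and the tree determines all three. Hence the product formula that follows.\<close>

lemma bij_betw_tree_split:
  assumes "simple_graph V E" "C \<subseteq> V"
  shows "bij_betw (\<lambda>(T1, T2, e). insert e (T1 \<union> T2))
    (spanning_trees C (induced E C) \<times> spanning_trees (V - C) (induced E (V - C)) \<times> cut E C)
    {T \<in> spanning_trees V E. \<exists>e. cut T C = {e}}"
proof (rule bij_betw_byWitness[where f' = "\<lambda>T. (induced T C, induced T (V - C), the_elem (cut T C))"])
  let ?A = "spanning_trees C (induced E C) \<times> spanning_trees (V - C) (induced E (V - C)) \<times> cut E C"
  let ?B = "{T \<in> spanning_trees V E. \<exists>e. cut T C = {e}}"
  let ?f = "\<lambda>(T1, T2, e). insert e (T1 \<union> T2)"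
  let ?g = "\<lambda>T. (induced T C, induced T (V - C), the_elem (cut T C))"
  have f: "?f x \<in> ?B \<and> ?g (?f x) = x" if x: "x \<in> ?A" for x
  proof -
    obtain T1 T2 e where [simp]: "x = (T1, T2, e)" by (cases x)
    have T: "T1 \<subseteq> induced E C" "T2 \<subseteq> induced E (V - C)" "e \<in> cut E C"
      "graph_tree C T1" "graph_tree (V - C) T2"
      using x by (auto simp: spanning_trees_def)
    let ?T = "insert e (T1 \<union> T2)"
    have TE: "?T \<subseteq> E" using T by (auto simp: induced_def cut_def)
    then have simp: "simple_graph V ?T" using assms(1) simple_graph_subset by blast
    have ne: "f \<noteq> {}" if "f \<in> E" for f using assms(1) that by (elim simple_graphE) auto
    have sub: "f \<subseteq> V" if "f \<in> E" for f using assms(1) that by (elim simple_graphE) auto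
    have e: "e \<inter> C \<noteq> {}" "\<not> e \<subseteq> C" "e \<in> E" using T(3) by (auto simp: cut_def)
    have s1: "f \<in> E \<and> f \<subseteq> C" if "f \<in> T1" for f using T(1) that by (auto simp: induced_def)
    have s2: "f \<in> E \<and> f \<subseteq> V - C" if "f \<in> T2" for f using T(2) that by (auto simp: induced_def)
    have cut: "cut ?T C = {e}"
      using e s1 s2 unfolding cut_def by blast
    \<comment> \<open>Edges are nonempty, so no edge of \<open>T2\<close> can lie in
      \<open>C\<close> as well.\<close>
    have i1: "induced ?T C = T1"
      using e s1 s2 ne unfolding induced_def by blast
    have i2: "induced ?T (V - C) = T2"
      using e s1 s2 ne unfolding induced_def by blast
    obtain u v where uv: "u \<in> V" "v \<in> V" "u \<in> C" "v \<notin> C" "e = {u, v}"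
      using simp cut by (elim cut_singletonE)
    have "graph_tree V ?T"
      using tree_split[OF simp assms(2)] cut i1 i2 uv T by auto
    then show ?thesis using TE cut i1 i2 by (simp add: spanning_trees_def)
  qed
  have g: "?g T \<in> ?A \<and> ?f (?g T) = T" if T: "T \<in> ?B" for T
  proof -
    obtain e where e: "cut T C = {e}" using T by blast
    have TE: "T \<subseteq> E" "graph_tree V T" using T by (auto simp: spanning_trees_def)
    then have simp: "simple_graph V T" using assms(1) simple_graph_subset by blast
    obtain u v where uv: "u \<in> V" "v \<in> V" "u \<in> C" "v \<notin> C" "e = {u, v}"
      using simp e by (elim cut_singletonE)
    have "graph_tree C (induced T C)" "graph_tree (V - C) (induced T (V - C))"
      using tree_split[OF simp assms(2)] e uv TE by auto
    moreover have "induced T W \<subseteq> induced E W" for W using TE by (auto simp: induced_def)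
    moreover have "cut T C \<subseteq> cut E C" using TE by (auto simp: cut_def)
    moreover have "T = cut T C \<union> induced T C \<union> induced T (V - C)"
    proof -
      have "f \<subseteq> V" if "f \<in> T" for f using simp that by (elim simple_graphE) auto
      then show ?thesis unfolding cut_def induced_def by blast
    qed
    ultimately show ?thesis using e by (auto simp: spanning_trees_def)
  qed
  show "\<forall>x\<in>?A. ?g (?f x) = x" using f by blast
  show "\<forall>T\<in>?B. ?f (?g T) = T" using g by blast
  show "?f ` ?A \<subseteq> ?B" using f by blast
  show "?g ` ?B \<subseteq> ?A" using g by blast
qed

lemma card_trees_single_cut:
  assumes "simple_graph V E" "C \<subseteq> V"
  shows "card {T \<in> spanning_trees V E. \<exists>e. cut T C = {e}} =
    card (spanning_trees C (induced E C)) * card (spanning_trees (V - C) (induced E (V - C))) * card (cut E C)"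
  using bij_betw_same_card[OF bij_betw_tree_split[OF assms]] by (simp add: card_cartesian_product)

section \<open>Pendant vertices and subdivided edges\<close>

lemma graph_tree_singleton: "graph_tree {w} {}"
  by (auto simp: graph_tree_def graph_connected_def graph_cycle_def intro!: exI[of _ 0])

lemma spanning_trees_singleton: "spanning_trees {w} {} = {{}}"
  using graph_tree_singleton by (auto simp: spanning_trees_def)

lemma induced_singleton: "simple_graph V E \<Longrightarrow> induced E {w} = {}"
  by (auto simp: induced_def elim: simple_graphE)

lemma graph_tree_leaf:
  assumes "simple_graph C F" "w \<notin> C" "u \<in> C"
  shows "graph_tree (insert w C) (insert {u, w} F) \<longleftrightarrow> graph_tree C F"
proof -
  let ?T = "insert {u, w} F"
  have sub: "f \<subseteq> C" "f \<noteq> {}" if "f \<in> F" for f using assms(1) that by (elim simple_graphE, auto)+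
  have simp: "simple_graph (insert w C) ?T"
    using assms simple_graph_mono[OF assms(1), of "insert w C"] by (auto simp: simple_graph_insert)
  have "cut ?T C = {{u, w}}" using assms sub by (auto simp: cut_def)
  moreover have "induced ?T C = F" using assms sub by (auto simp: induced_def)
  moreover have "insert w C - C = {w}" using assms(2) by blast
  moreover have "induced ?T {w} = {}" by (rule induced_singleton[OF simp])
  ultimately show ?thesis
    using tree_split[OF simp, of C u w] assms graph_tree_singleton[of w] by auto
qed

text \<open>Connectedness forces every spanning tree to use the only edge at \<open>w\<close>, so
  all of them cross \<open>V\<close> once; in the product formula the factors for \<open>{w}\<close>
  and for the cut are 1.\<close>

lemma card_spanning_trees_leaf:
  assumes "simple_graph (insert w V) E" "w \<notin> V" "u \<in> V" "cut E V = {{u, w}}"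
  shows "card (spanning_trees (insert w V) E) = card (spanning_trees V (induced E V))"
proof -
  have "\<exists>e. cut T V = {e}" if "T \<in> spanning_trees (insert w V) E" for T
  proof -
    have "cut T V \<subseteq> cut E V" using that by (auto simp: spanning_trees_def cut_def)
    moreover have "cut T V \<noteq> {}"
      using graph_connected_cut_nonempty[of "insert w V" T u V w] that assms(2,3)
      by (auto simp: spanning_trees_def graph_tree_def)
    ultimately show ?thesis using assms(4) by auto
  qed
  then have "spanning_trees (insert w V) E = {T \<in> spanning_trees (insert w V) E. \<exists>e. cut T V = {e}}"
    by blast
  also have "card \<dots> = card (spanning_trees V (induced E V))"
    using card_trees_single_cut[OF assms(1), of V] assms induced_singleton[OF assms(1), of w]
    by (auto simp: spanning_trees_singleton insert_Diff_if)
  finally show ?thesis .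
qed

text \<open>Both trees are governed by the same set \<open>C\<close> separating \<open>u\<close>
  from \<open>v\<close> in \<open>F\<close>: one splits at \<open>{u, v}\<close>, the other at
  \<open>{a, b}\<close>, where \<open>a\<close> and \<open>b\<close> are mere leaves attached to the
  two sides.\<close>

lemma graph_tree_detour:
  assumes "simple_graph V F" "u \<in> V" "v \<in> V" "u \<noteq> v" "a \<notin> V" "b \<notin> V" "a \<noteq> b" "{u, v} \<notin> F"
  shows "graph_tree V (insert {u, v} F) \<longleftrightarrow>
    graph_tree (insert a (insert b V)) ({{u, a}, {a, b}, {v, b}} \<union> F)"
proof -
  let ?T = "insert {u, v} F" and ?T' = "{{u, a}, {a, b}, {v, b}} \<union> F"
  let ?V' = "insert a (insert b V)"
  have sub: "f \<subseteq> V" "f \<noteq> {}" if "f \<in> F" for f using assms(1) that by (elim simple_graphE, auto)+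
  have simp: "simple_graph V ?T" using assms by (simp add: simple_graph_insert)
  have simp': "simple_graph ?V' ?T'"
    using assms(2-7) simple_graph_mono[OF assms(1), of ?V'] by (auto simp: simple_graph_insert)
  \<comment> \<open>The equivalence for a given separating set. Each direction then only has to
    produce one, from the bridge \<open>{u, v}\<close> or from the bridge
    \<open>{a, b}\<close>.\<close>
  have key: "graph_tree V ?T \<longleftrightarrow> graph_tree ?V' ?T'"
    if C: "C \<subseteq> V" "u \<in> C" "v \<notin> C" "cut F C = {}" for C
  proof -
    have dich: "f \<subseteq> C \<or> f \<subseteq> V - C" if "f \<in> F" for f
      using C(4) that sub[OF that] unfolding cut_def by blast
    have "cut ?T C = {{u, v}}" using C by (auto simp: cut_def)
    moreover have "induced ?T C = induced F C" "induced ?T (V - C) = induced F (V - C)"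
      using C by (auto simp: induced_def)
    ultimately have 1: "graph_tree V ?T \<longleftrightarrow>
        graph_tree C (induced F C) \<and> graph_tree (V - C) (induced F (V - C))"
      using tree_split[OF simp C(1) _ C(2,3)] by simp
    have aC: "a \<notin> C" "b \<notin> C" using C assms by blast+
    have k1: "cut ?T' (insert a C) = {{a, b}}"
    proof -
      have "f \<notin> cut ?T' (insert a C)" if "f \<in> F" for f
        using dich[OF that] assms(5) aC unfolding cut_def by blast
      moreover have "{a, b} \<in> cut ?T' (insert a C)" "{u, a} \<notin> cut ?T' (insert a C)" "{v, b} \<notin> cut ?T' (insert a C)"
        using aC C assms by (auto simp: cut_def)
      moreover have "cut ?T' (insert a C) \<subseteq> ?T'" by (auto simp: cut_def)
      ultimately show ?thesis by blast
    qed
    have k2: "induced ?T' (insert a C) = insert {u, a} (induced F C)"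
    proof -
      have "f \<subseteq> insert a C \<longleftrightarrow> f \<subseteq> C" if "f \<in> F" for f
        using sub[OF that] assms(5) by blast
      then show ?thesis using C assms aC by (auto simp: induced_def)
    qed
    have k3: "?V' - insert a C = insert b (V - C)" using assms aC by blast
    have k4: "induced ?T' (insert b (V - C)) = insert {v, b} (induced F (V - C))"
    proof -
      have "f \<subseteq> insert b (V - C) \<longleftrightarrow> f \<subseteq> V - C" if "f \<in> F" for f
        using sub[OF that] assms(6) by blast
      then show ?thesis using C assms aC by (auto simp: induced_def)
    qed
    have "graph_tree ?V' ?T' \<longleftrightarrow> graph_tree (insert a C) (insert {u, a} (induced F C))
        \<and> graph_tree (insert b (V - C)) (insert {v, b} (induced F (V - C)))"
      unfolding k2[symmetric] k4[symmetric] k3[symmetric]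
      by (rule tree_split[OF simp' _ k1]) (use C(1) aC assms(7) in auto)
    also have "\<dots> \<longleftrightarrow> graph_tree C (induced F C) \<and> graph_tree (V - C) (induced F (V - C))"
      using graph_tree_leaf[OF simple_graph_induced[OF assms(1)], of a C u]
        graph_tree_leaf[OF simple_graph_induced[OF assms(1)], of b "V - C" v] C(2,3) assms(3,6) aC by simp
    finally show ?thesis using 1 by blast
  qed
  show ?thesis
  proof
    assume T: "graph_tree V ?T"
    obtain C where C: "C \<subseteq> V" "u \<in> C" "v \<notin> C" "cut ?T C = {{u, v}}"
      using tree_edge_cut[OF simp T, of u v] by blast
    have "cut F C \<subseteq> cut ?T C \<inter> F" by (auto simp: cut_def)
    then have "cut F C = {}" using C(4) assms(8) by auto
    then show "graph_tree ?V' ?T'" using key C T by blast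
  next
    assume T: "graph_tree ?V' ?T'"
    obtain C where C: "C \<subseteq> ?V'" "a \<in> C" "b \<notin> C" "cut ?T' C = {{a, b}}"
      using tree_edge_cut[OF simp' T, of a b] by blast
    have "u \<in> C"
    proof (rule ccontr)
      assume "u \<notin> C"
      then have "{u, a} \<in> cut ?T' C" using C(2) by (auto simp: cut_def)
      then show False using C(4) assms(2,6,5) by (auto simp: doubleton_eq_iff)
    qed
    moreover have "v \<notin> C"
    proof
      assume "v \<in> C"
      then have "{v, b} \<in> cut ?T' C" using C(3) by (auto simp: cut_def)
      then show False using C(4) assms(3,6,5) by (auto simp: doubleton_eq_iff)
    qed
    \<comment> \<open>The set obtained from the larger graph contains \<open>a\<close>, hence the
      intersection with \<open>V\<close>. An edge of \<open>F\<close> crossing it would be a second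
      edge in the cut of the larger tree.\<close>
    moreover have "cut F (C \<inter> V) = {}"
    proof (rule ccontr)
      assume "cut F (C \<inter> V) \<noteq> {}"
      then obtain f where f: "f \<in> F" "f \<inter> (C \<inter> V) \<noteq> {}" "\<not> f \<subseteq> C \<inter> V" unfolding cut_def by blast
      then have "f \<in> cut ?T' C" using sub[of f] unfolding cut_def by blast
      then have "a \<in> f" using C(4) by simp
      then show False using sub[of f] f(1) assms(5) by blast
    qed
    ultimately show "graph_tree V ?T" using key[of "C \<inter> V"] assms(2) T by blast
  qed
qed

lemma cut_insert: "cut (insert f F) C = (if f \<inter> C \<noteq> {} \<and> \<not> f \<subseteq> C then insert f (cut F C) else cut F C)"
  by (auto simp: cut_def)

lemma cut_eq_Int: "T \<subseteq> E \<Longrightarrow> cut T C = cut E C \<inter> T"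
  by (auto simp: cut_def)

lemma cut_verts: "simple_graph V F \<Longrightarrow> V \<subseteq> C \<Longrightarrow> cut F C = {}"
  by (auto simp: cut_def elim: simple_graphE)

lemma induced_insert: "induced (insert f F) C = (if f \<subseteq> C then insert f (induced F C) else induced F C)"
  by (auto simp: induced_def)

lemma induced_verts: "simple_graph V F \<Longrightarrow> V \<subseteq> C \<Longrightarrow> induced F C = F"
  by (auto simp: induced_def elim: simple_graphE)

lemma finite_simple_graph: "finite V \<Longrightarrow> simple_graph V E \<Longrightarrow> finite E"
  by (rule finite_subset[of _ "Pow V"]) (auto elim: simple_graphE)

lemma finite_spanning_trees: "finite E \<Longrightarrow> finite (spanning_trees V E)"
  by (rule finite_subset[of _ "Pow E"]) (auto simp: spanning_trees_def)

lemma spanning_trees_avoiding: "{T \<in> spanning_trees V E. e \<notin> T} = spanning_trees V (E - {e})"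
  by (auto simp: spanning_trees_def)

lemma card_Un3:
  assumes "S = A \<union> (B \<union> C)" "A \<inter> (B \<union> C) = {}" "B \<inter> C = {}" "finite A" "finite B" "finite C"
  shows "card S = card A + (card B + card C)"
  using assms by (simp add: card_Un_disjoint)

section \<open>Attaching a new rung \<open>{a, b}\<close> to an old edge
  \<open>{u, v}\<close>\<close>

context
  fixes V :: "'a set" and E :: "'a set set" and u v a b :: 'a
  assumes fin: "finite V" and sg: "simple_graph V E"
    and uv: "{u, v} \<in> E" and ab: "a \<notin> V" "b \<notin> V" "a \<noteq> b"
begin

private abbreviation (input) "V' \<equiv> insert a (insert b V)"
private abbreviation (input) "E' \<equiv> {{u, a}, {a, b}, {v, b}} \<union> E"

private lemma uvV: "u \<in> V" "v \<in> V" "u \<noteq> v"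
  using simple_graph_edgeD[OF sg uv] by auto

private lemma distinct_verts:
  "u \<noteq> a" "u \<noteq> b" "v \<noteq> a" "v \<noteq> b" "a \<noteq> u" "a \<noteq> v" "b \<noteq> u" "b \<noteq> v" "b \<noteq> a" "v \<noteq> u"
  using uvV ab by auto

private lemma not_in_E: "{u, a} \<notin> E" "{a, b} \<notin> E" "{v, b} \<notin> E"
  using simple_graph_edgeD[OF sg] ab by blast+

private lemma sg': "simple_graph V' E'"
  using uvV distinct_verts simple_graph_mono[OF sg, of V'] ab by (auto simp: simple_graph_insert)

private lemma finE: "finite E" "finite E'"
  using finite_simple_graph[OF fin sg] by auto

text \<open>Without the rung, \<open>a\<close> and \<open>b\<close> are leaves at \<open>u\<close>
  and \<open>v\<close> and are removed one after the other.\<close>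

lemma card_spanning_trees_avoiding_rung:
  "card {T \<in> spanning_trees V' E'. {a, b} \<notin> T} = card (spanning_trees V E)"
proof -
  let ?E = "insert {u, a} (insert {v, b} E)"
  have E: "E' - {{a, b}} = ?E"
    using not_in_E distinct_verts ab(3) by (auto simp: doubleton_eq_iff)
  have s2: "simple_graph V' ?E" by (rule simple_graph_subset[OF sg']) blast
  have c: "cut E (insert b V) = {}" "cut E V = {}" "induced E (insert b V) = E" "induced E V = E"
    by (auto simp: cut_verts[OF sg] induced_verts[OF sg] subset_insertI)
  have "card (spanning_trees V' ?E) = card (spanning_trees (insert b V) (induced ?E (insert b V)))"
    by (rule card_spanning_trees_leaf[OF s2, of u]) (use c uvV distinct_verts ab in \<open>auto simp: cut_insert\<close>)
  also have "induced ?E (insert b V) = insert {v, b} E"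
    using c distinct_verts ab uvV by (auto simp: induced_insert)
  also have "card (spanning_trees (insert b V) (insert {v, b} E)) =
      card (spanning_trees V (induced (insert {v, b} E) V))"
    by (rule card_spanning_trees_leaf[of _ _ _ v])
      (use c uvV distinct_verts ab simple_graph_mono[OF sg, of "insert b V"] in
        \<open>auto simp: cut_insert simple_graph_insert\<close>)
  also have "induced (insert {v, b} E) V = E" using c ab by (auto simp: induced_insert)
  finally show ?thesis unfolding spanning_trees_avoiding E .
qed

text \<open>The other side of the cut is the single edge \<open>{a, b}\<close>, which has one
  spanning tree; the factor 2 is the choice between \<open>{u, a}\<close> and
  \<open>{v, b}\<close>.\<close>

private lemma card_spanning_trees_single:
  "card {T \<in> spanning_trees V' E'. \<exists>e. cut T V = {e}} = 2 * card (spanning_trees V E)"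
proof -
  have "card (spanning_trees {a, b} {{a, b}}) = card (spanning_trees {b} (induced {{a, b}} {b}))"
    by (rule card_spanning_trees_leaf[of _ _ _ b])
      (use ab in \<open>auto simp: cut_insert simple_graph_insert cut_def simple_graph_def\<close>)
  also have "induced {{a, b}} {b} = {}" using ab by (auto simp: induced_def)
  finally have 1: "card (spanning_trees {a, b} {{a, b}}) = 1" by (simp add: spanning_trees_singleton)
  have 2: "induced E' V = E" using ab induced_verts[OF sg] by (simp add: induced_insert)
  have "induced E {a, b} = {}" using ab by (auto simp: induced_def elim!: simple_graphE[OF sg])
  then have 3: "induced E' {a, b} = {{a, b}}" using uvV distinct_verts by (auto simp: induced_insert)
  have "cut E' V = {{u, a}, {v, b}}" using uvV ab cut_verts[OF sg] by (auto simp: cut_insert)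
  then have 4: "card (cut E' V) = 2" using distinct_verts uvV by (simp add: doubleton_eq_iff)
  have 5: "V' - V = {a, b}" using ab by blast
  show ?thesis
    using card_trees_single_cut[OF sg', of V] 1 2 3 4 unfolding 5 by (simp add: subset_insertI2 subset_insertI)
qed

text \<open>Both families are parametrised by the remaining edges \<open>F\<close>, completed either
  by \<open>{u, v}\<close> or by the three-edge detour; \<open>graph_tree_detour\<close> says that
  the conditions on \<open>F\<close> agree.\<close>

private lemma card_spanning_trees_detour:
  "card {T \<in> spanning_trees V' E'. {{u, a}, {a, b}, {v, b}} \<subseteq> T} = card {T \<in> spanning_trees V E. {u, v} \<in> T}"
proof -
  let ?X = "{{u, a}, {a, b}, {v, b}}"
  let ?F = "{F. F \<subseteq> E - {{u, v}} \<and> graph_tree V (insert {u, v} F)}"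
  have iff: "graph_tree V (insert {u, v} F) \<longleftrightarrow> graph_tree V' (?X \<union> F)" if "F \<subseteq> E - {{u, v}}" for F
    using graph_tree_detour[of V F u v a b] simple_graph_subset[OF sg, of F] that uvV ab by blast
  have XE: "?X \<inter> E = {}" using not_in_E by blast
  have "{T \<in> spanning_trees V E. {u, v} \<in> T} = insert {u, v} ` ?F"
  proof -
    have "T \<in> insert {u, v} ` ?F" if "T \<in> spanning_trees V E" "{u, v} \<in> T" for T
    proof -
      have "T = insert {u, v} (T - {{u, v}})" using that(2) by blast
      moreover have "T - {{u, v}} \<in> ?F"
        using that by (auto simp: spanning_trees_def insert_absorb)
      ultimately show ?thesis by blast
    qed
    then show ?thesis using uv by (auto simp: spanning_trees_def)
  qed
  moreover have "inj_on (insert {u, v}) ?F" by (auto simp: inj_on_def)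
  ultimately have 1: "card {T \<in> spanning_trees V E. {u, v} \<in> T} = card ?F"
    by (simp add: card_image)
  define X where "X = ?X"
  have edges: "{u, a} \<in> X" "{a, b} \<in> X" "{v, b} \<in> X" by (simp_all add: X_def)
  have E': "E' = X \<union> E" by (simp add: X_def)
  note iff = iff[folded X_def] and XE = XE[folded X_def] and simp' = sg'[unfolded E']
  have "{T \<in> spanning_trees V' (X \<union> E). X \<subseteq> T} = (\<union>) X ` ?F"
  proof -
    have "T \<in> (\<union>) X ` ?F" if "T \<in> spanning_trees V' (X \<union> E)" "X \<subseteq> T" for T
    proof -
      have T: "T = X \<union> (T - X)" using that(2) by blast
      have tr: "graph_tree V' T" and sub: "T \<subseteq> (X \<union> E)" using that(1) by (auto simp: spanning_trees_def)
      \<comment> \<open>Otherwise \<open>u\<close>, \<open>a\<close>, \<open>b\<close>,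
        \<open>v\<close> would form a 4-cycle. In terms of cuts: the set split off by the bridge
        \<open>{u, v}\<close> must contain \<open>a\<close> and miss \<open>b\<close>, and then
        \<open>{a, b}\<close> crosses it too.\<close>
      have "{u, v} \<notin> T"
      proof
        assume "{u, v} \<in> T"
        obtain C where C: "u \<in> C" "v \<notin> C" "cut T C = {{u, v}}"
          by (rule tree_edge_cut[OF simple_graph_subset[OF simp' sub] tr \<open>{u, v} \<in> T\<close>])
        have "a \<in> C"
        proof (rule ccontr)
          assume "a \<notin> C"
          then have "{u, a} \<in> cut T C" using C(1,2) subsetD[OF that(2)] edges by (simp add: cut_def)
          then show False using C(3) distinct_verts by (simp add: doubleton_eq_iff)
        qed
        moreover have "b \<notin> C"
        proof
          assume "b \<in> C"
          then have "{v, b} \<in> cut T C" using C(1,2) subsetD[OF that(2)] edges by (simp add: cut_def)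
          then show False using C(3) distinct_verts by (simp add: doubleton_eq_iff)
        qed
        ultimately have "{a, b} \<in> cut T C" using subsetD[OF that(2)] edges by (simp add: cut_def)
        then show False using C(3) distinct_verts by (simp add: doubleton_eq_iff)
      qed
      then have "T - X \<subseteq> E - {{u, v}}" using sub by blast
      moreover from this have "graph_tree V (insert {u, v} (T - X))" using iff tr T[symmetric] by metis
      ultimately have "T - X \<in> ?F" by blast
      then show ?thesis by (rule image_eqI[where f = "(\<union>) X", OF T])
    qed
    moreover have "X \<union> F \<in> {T \<in> spanning_trees V' (X \<union> E). X \<subseteq> T}" if "F \<in> ?F" for F
    proof -
      have "X \<union> F \<subseteq> (X \<union> E)" using that by blast
      moreover have "graph_tree V' (X \<union> F)" using that iff[of F] by blast
      ultimately show ?thesis by (simp add: spanning_trees_def)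
    qed
    ultimately show ?thesis by (intro equalityI subsetI) (simp_all only: mem_Collect_eq image_iff, blast+)
  qed
  moreover have "inj_on ((\<union>) X) ?F"
  proof (rule inj_onI)
    fix F G assume FG: "F \<in> ?F" "G \<in> ?F" "X \<union> F = X \<union> G"
    then have "X \<inter> F = {}" "X \<inter> G = {}" using XE by blast+
    then show "F = G" using FG(3) by blast
  qed
  ultimately have "card {T \<in> spanning_trees V' (X \<union> E). X \<subseteq> T} = card ?F"
    by (simp add: card_image)
  then show ?thesis unfolding E'[symmetric] X_def using 1 by simp
qed

text \<open>The trees are sorted by the new edges they contain: exactly one of \<open>{u, a}\<close>
  and \<open>{v, b}\<close> gives twice the old number, both without the rung gives it once more,
  and all three give the last term.\<close>

lemma card_spanning_trees_attach_rung:
  "card (spanning_trees V' E') = 3 * card (spanning_trees V E) + card {T \<in> spanning_trees V E. {u, v} \<in> T}"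
proof -
  let ?S = "spanning_trees V' E'"
  let ?A = "{T \<in> ?S. \<exists>e. cut T V = {e}}" and ?B = "{T \<in> ?S. {a, b} \<notin> T}"
    and ?C = "{T \<in> ?S. {{u, a}, {a, b}, {v, b}} \<subseteq> T}"
  have fin: "finite ?S" by (rule finite_spanning_trees[OF finE(2)])
  have cutE: "cut E' V = {{u, a}, {v, b}}" using uvV ab cut_verts[OF sg] by (auto simp: cut_insert)
  have sub: "cut T V = {{u, a}, {v, b}} \<inter> T" if "T \<in> ?S" for T
    unfolding cutE[symmetric] by (rule cut_eq_Int) (use that in \<open>simp add: spanning_trees_def\<close>)
  have ne: "{u, a} \<noteq> {v, b}" using distinct_verts uvV by (simp add: doubleton_eq_iff)
  have nonempty: "cut T V \<noteq> {}" if "T \<in> ?S" for T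
    using graph_connected_cut_nonempty[of V' T u V a] that uvV ab
    by (auto simp: spanning_trees_def graph_tree_def)
  have single: "(\<exists>e. cut T V = {e}) \<longleftrightarrow> \<not> ({u, a} \<in> T \<and> {v, b} \<in> T)" if "T \<in> ?S" for T
    using nonempty[OF that] ne unfolding sub[OF that]
    by (cases "{u, a} \<in> T"; cases "{v, b} \<in> T") (simp_all add: Int_insert_left)
  \<comment> \<open>With the rung absent, \<open>{u, a}\<close> is the only possible edge at
    \<open>a\<close> and \<open>{v, b}\<close> the only one at \<open>b\<close>.\<close>
  have B: "{u, a} \<in> T \<and> {v, b} \<in> T" if "T \<in> ?B" for T
  proof -
    have T: "graph_connected V' T" "T \<subseteq> E'" "{a, b} \<notin> T"
      using that by (auto simp: spanning_trees_def graph_tree_def)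
    have "cut E {a} = {}" "cut E {b} = {}" using ab by (auto simp: cut_def elim!: simple_graphE[OF sg])
    then have "cut E' {a} = {{u, a}, {a, b}}" "cut E' {b} = {{v, b}, {a, b}}"
      using distinct_verts ab by (auto simp: cut_insert)
    moreover have "cut T {a} \<subseteq> cut E' {a} \<inter> T" "cut T {b} \<subseteq> cut E' {b} \<inter> T"
      using T(2) by (auto simp: cut_def)
    moreover have "cut T {a} \<noteq> {}" "cut T {b} \<noteq> {}"
      using graph_connected_cut_nonempty[OF T(1), of a "{a}" u]
        graph_connected_cut_nonempty[OF T(1), of b "{b}" u] uvV distinct_verts by auto
    ultimately have "cut T {a} \<subseteq> {{u, a}, {a, b}} \<inter> T" "cut T {b} \<subseteq> {{v, b}, {a, b}} \<inter> T"
        "cut T {a} \<noteq> {}" "cut T {b} \<noteq> {}" by simp_all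
    then show ?thesis using T(3) by blast
  qed
  have "?S = ?A \<union> (?B \<union> ?C)"
  proof (rule equalityI; rule subsetI)
    fix T assume T: "T \<in> ?S"
    show "T \<in> ?A \<union> (?B \<union> ?C)" using T single[OF T] by simp
  qed blast
  moreover have "?A \<inter> (?B \<union> ?C) = {}"
  proof -
    have "{u, a} \<in> T \<and> {v, b} \<in> T" if "T \<in> ?B \<union> ?C" for T using that B by blast
    moreover have "\<not> ({u, a} \<in> T \<and> {v, b} \<in> T)" if "T \<in> ?A" for T using that single[of T] by simp
    ultimately show ?thesis by (meson disjoint_iff)
  qed
  moreover have "?B \<inter> ?C = {}" by auto
  moreover have "finite ?A" "finite ?B" "finite ?C" using fin by simp_all
  ultimately have "card ?S = card ?A + (card ?B + card ?C)"
    by (rule card_Un3)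
  then show ?thesis
    using card_spanning_trees_single card_spanning_trees_avoiding_rung card_spanning_trees_detour by simp
qed

end

section \<open>Ladder grids\<close>

definition adj :: "int \<times> int \<Rightarrow> int \<times> int \<Rightarrow> bool" where
  "adj x y \<longleftrightarrow> \<bar>fst x - fst y\<bar> + \<bar>snd x - snd y\<bar> = 1"

text \<open>Defined for arbitrary vertex sets, so that the sides of a cut, which are blocks with
  pendant paths, are graphs of the same kind.\<close>

definition grid_on :: "(int \<times> int) set \<Rightarrow> (int \<times> int) set set" where
  "grid_on W = {{x, y} | x y. x \<in> W \<and> y \<in> W \<and> adj x y}"

definition tau :: "(int \<times> int) set \<Rightarrow> nat" where
  "tau W = card (spanning_trees W (grid_on W))"

definition block :: "int \<Rightarrow> int \<Rightarrow> (int \<times> int) set" where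
  "block a b = {1, 2} \<times> {a..b}"

lemma adj_commute: "adj x y \<longleftrightarrow> adj y x"
  by (auto simp: adj_def)

lemma adj_irrefl: "adj x y \<Longrightarrow> x \<noteq> y"
  by (auto simp: adj_def)

lemma grid_edges_eq: "grid_edges n = grid_on (grid_verts n)"
  unfolding grid_edges_def grid_on_def adj_def by fastforce

lemma grid_verts_eq: "grid_verts n = block 1 (int n)"
  by (simp add: grid_verts_def block_def)

lemma grid_on_iff: "{x, y} \<in> grid_on W \<longleftrightarrow> x \<in> W \<and> y \<in> W \<and> adj x y"
  unfolding grid_on_def mem_Collect_eq doubleton_eq_iff using adj_commute by blast

lemma grid_onE:
  assumes "e \<in> grid_on W"
  obtains x y where "e = {x, y}" "x \<in> W" "y \<in> W" "adj x y"
  using assms unfolding grid_on_def by blast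

lemma simple_graph_grid_on: "simple_graph W (grid_on W)"
  unfolding simple_graph_def grid_on_def using adj_irrefl by blast

lemma induced_grid_on: "W \<subseteq> V \<Longrightarrow> induced (grid_on V) W = grid_on W"
  by (auto simp: induced_def grid_on_iff elim!: grid_onE)

lemma cut_grid_on:
  assumes "C \<subseteq> V"
  shows "cut (grid_on V) C = {{x, y} | x y. x \<in> C \<and> y \<in> V - C \<and> adj x y}"
proof (rule equalityI; rule subsetI)
  fix e assume "e \<in> cut (grid_on V) C"
  then obtain x y where "e = {x, y}" "x \<in> V" "y \<in> V" "adj x y" "e \<inter> C \<noteq> {}" "\<not> e \<subseteq> C"
    unfolding cut_def grid_on_def by blast
  then have "e = {x, y} \<and> x \<in> C \<and> y \<in> V - C \<and> adj x y \<or> e = {y, x} \<and> y \<in> C \<and> x \<in> V - C \<and> adj y x"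
    by (auto simp: adj_commute)
  then show "e \<in> {{x, y} | x y. x \<in> C \<and> y \<in> V - C \<and> adj x y}" by blast
next
  fix e assume "e \<in> {{x, y} | x y. x \<in> C \<and> y \<in> V - C \<and> adj x y}"
  then show "e \<in> cut (grid_on V) C" using assms by (auto simp: cut_def grid_on_iff)
qed

lemma grid_on_insert:
  assumes "w \<notin> W"
  shows "grid_on (insert w W) = (\<lambda>u. {u, w}) ` {u \<in> W. adj u w} \<union> grid_on W"
proof (rule equalityI; rule subsetI)
  fix e assume "e \<in> grid_on (insert w W)"
  then obtain x y where e: "e = {x, y}" "x \<in> insert w W" "y \<in> insert w W" "adj x y"
    unfolding grid_on_def by blast
  consider "x = w" "y \<in> W" | "y = w" "x \<in> W" | "x \<in> W" "y \<in> W" using e adj_irrefl by blast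
  then show "e \<in> (\<lambda>u. {u, w}) ` {u \<in> W. adj u w} \<union> grid_on W"
  proof cases
    case 1
    then have "e = {y, w}" "y \<in> {u \<in> W. adj u w}" using e adj_commute by auto
    then show ?thesis by blast
  next
    case 2
    then show ?thesis using e by blast
  next
    case 3
    then show ?thesis using e by (simp add: grid_on_iff)
  qed
qed (use assms in \<open>auto simp: grid_on_iff elim!: grid_onE\<close>)

lemma tau_singleton: "tau {w} = 1"
proof -
  have "grid_on {w} = {}" by (auto simp: grid_on_def dest: adj_irrefl)
  then show ?thesis by (simp add: tau_def spanning_trees_singleton)
qed

lemma tau_leaf:
  assumes "w \<notin> W" "u \<in> W" "\<And>x. x \<in> W \<Longrightarrow> adj x w \<longleftrightarrow> x = u"
  shows "tau (insert w W) = tau W"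
proof -
  have "cut (grid_on (insert w W)) W = {{u, w}}"
  proof -
    have "insert w W - W = {w}" using assms(1) by blast
    then show ?thesis using assms(2,3) by (subst cut_grid_on) blast+
  qed
  then show ?thesis
    using card_spanning_trees_leaf[OF simple_graph_grid_on assms(1,2)]
    by (simp add: tau_def induced_grid_on subset_insertI)
qed

text \<open>Each added vertex is a leaf: with \<open>W\<close> confined to columns up to
  \<open>p\<close>, its only neighbour already present is the one to its left. A pendant path
  therefore does not change the count.\<close>

lemma tau_right_tail:
  assumes "\<And>x. x \<in> W \<Longrightarrow> snd x \<le> p" "(r, p) \<in> W"
  shows "tau (W \<union> {r} \<times> {p + 1..p + int k}) = tau W"
proof (induction k)
  case 0
  show ?case by simp
next
  case (Suc k)
  let ?W = "W \<union> {r} \<times> {p + 1..p + int k}"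
  have W: "snd x \<le> p + int k" if "x \<in> ?W" for x using that assms(1)[of x] by auto
  have u: "(r, p + int k) \<in> ?W" using assms(2) by (cases k) auto
  have "tau (insert (r, p + int k + 1) ?W) = tau ?W"
  proof (rule tau_leaf[OF _ u])
    show "(r, p + int k + 1) \<notin> ?W" using W by fastforce
    show "adj x (r, p + int k + 1) \<longleftrightarrow> x = (r, p + int k)" if "x \<in> ?W" for x
      using W[OF that] by (cases x) (auto simp: adj_def)
  qed
  also have "insert (r, p + int k + 1) ?W = W \<union> {r} \<times> {p + 1..p + int (Suc k)}"
    by auto
  finally show ?case using Suc by simp
qed

lemma tau_left_tail:
  assumes "\<And>x. x \<in> W \<Longrightarrow> snd x \<ge> p" "(r, p) \<in> W"
  shows "tau (W \<union> {r} \<times> {p - int k..p - 1}) = tau W"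
proof (induction k)
  case 0
  show ?case by simp
next
  case (Suc k)
  let ?W = "W \<union> {r} \<times> {p - int k..p - 1}"
  have W: "snd x \<ge> p - int k" if "x \<in> ?W" for x using that assms(1)[of x] by auto
  have u: "(r, p - int k) \<in> ?W" using assms(2) by (cases k) auto
  have "tau (insert (r, p - int k - 1) ?W) = tau ?W"
  proof (rule tau_leaf[OF _ u])
    show "(r, p - int k - 1) \<notin> ?W" using W by fastforce
    show "adj x (r, p - int k - 1) \<longleftrightarrow> x = (r, p - int k)" if "x \<in> ?W" for x
      using W[OF that] by (cases x) (auto simp: adj_def)
  qed
  also have "insert (r, p - int k - 1) ?W = W \<union> {r} \<times> {p - int (Suc k)..p - 1}"
    by auto
  finally show ?case using Suc by simp
qed

section \<open>Spanning trees of rectangular blocks\<close>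

lemma finite_block: "finite (block a b)"
  by (simp add: block_def)

lemma block_extend: "a \<le> b \<Longrightarrow> block a (b + 1) = insert (1, b + 1) (insert (2, b + 1) (block a b))"
  by (auto simp: block_def)

lemma grid_on_block_extend:
  assumes "a \<le> b"
  shows "grid_on (block a (b + 1)) =
    {{(1, b), (1, b + 1)}, {(1, b + 1), (2, b + 1)}, {(2, b), (2, b + 1)}} \<union> grid_on (block a b)"
proof -
  have 1: "{u \<in> block a b. adj u (2, b + 1)} = {(2, b)}"
    using assms by (auto simp: block_def adj_def)
  have 2: "{u \<in> insert (2, b + 1) (block a b). adj u (1, b + 1)} = {(1, b), (2, b + 1)}"
    using assms by (auto simp: block_def adj_def)
  show ?thesis
    unfolding block_extend[OF assms]
    by (subst grid_on_insert, simp add: block_def, subst 2, subst grid_on_insert, simp add: block_def, subst 1)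
      (simp add: insert_commute)
qed

context
  fixes a b :: int assumes ab: "a \<le> b"
begin

private lemma attach_hyps:
  "finite (block a b)" "simple_graph (block a b) (grid_on (block a b))"
  "{(1, b), (2, b)} \<in> grid_on (block a b)" "(1, b + 1) \<notin> block a b" "(2, b + 1) \<notin> block a b"
  "(1::int, b + 1) \<noteq> (2, b + 1)"
  using ab by (auto simp: finite_block simple_graph_grid_on grid_on_iff) (auto simp: block_def adj_def)

lemma tau_block_avoiding_rung:
  "card {T \<in> spanning_trees (block a (b + 1)) (grid_on (block a (b + 1))). {(1, b + 1), (2, b + 1)} \<notin> T}
    = tau (block a b)"
  using card_spanning_trees_avoiding_rung[OF attach_hyps]
  unfolding tau_def block_extend[OF ab, symmetric] grid_on_block_extend[OF ab, symmetric] .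

lemma tau_block_extend:
  "tau (block a (b + 1)) = 3 * tau (block a b) +
    card {T \<in> spanning_trees (block a b) (grid_on (block a b)). {(1, b), (2, b)} \<in> T}"
  using card_spanning_trees_attach_rung[OF attach_hyps]
  unfolding tau_def block_extend[OF ab, symmetric] grid_on_block_extend[OF ab, symmetric] .

end

text \<open>The empty graph is not connected here, and the value 0 is exactly the initial value that
  the recurrence needs.\<close>

lemma tau_empty: "tau {} = 0"
  by (simp add: tau_def spanning_trees_def graph_tree_def graph_connected_def)

lemma block_single: "block a a = {(1, a), (2, a)}"
  by (auto simp: block_def)

lemma tau_block_single: "tau (block a a) = 1"
  using tau_leaf[of "(1, a)" "{(2, a)}" "(2, a)"]
  by (simp add: block_single tau_singleton adj_def)

text \<open>For a single column the rung is the only edge and cannot be avoided, which fits the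
  empty block on the right having no tree.\<close>

lemma tau_block_avoiding_last_rung:
  assumes "a \<le> b"
  shows "card {T \<in> spanning_trees (block a b) (grid_on (block a b)). {(1, b), (2, b)} \<notin> T} = tau (block a (b - 1))"
proof (cases "a = b")
  case True
  have "T \<notin> spanning_trees (block b b) (grid_on (block b b))" if "{(1, b), (2, b)} \<notin> T" for T
  proof
    assume T: "T \<in> spanning_trees (block b b) (grid_on (block b b))"
    then have "cut T {(1, b)} \<noteq> {}"
      using graph_connected_cut_nonempty[of "block b b" T "(1, b)" "{(1, b)}" "(2, b)"]
      by (auto simp: spanning_trees_def graph_tree_def block_single)
    moreover have "T \<subseteq> grid_on (block b b)" using T by (simp add: spanning_trees_def)
    moreover have "grid_on (block b b) \<subseteq> {{(1, b), (2, b)}}"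
      by (auto simp: grid_on_def block_single adj_def)
    ultimately have "{(1, b), (2, b)} \<in> T" unfolding cut_def by blast
    then show False using that by blast
  qed
  then have "{T \<in> spanning_trees (block b b) (grid_on (block b b)). {(1, b), (2, b)} \<notin> T} = {}" by blast
  moreover have "block b (b - 1) = {}" by (simp add: block_def)
  ultimately show ?thesis unfolding True by (simp only: card.empty tau_empty)
next
  case False
  then show ?thesis using tau_block_avoiding_rung[of a "b - 1"] assms by simp
qed

text \<open>In \<open>tau_block_extend\<close> the trees containing the last rung are all trees
  minus those avoiding it. The result is written as a sum to stay clear of truncated
  subtraction.\<close>

lemma tau_block_rec:
  assumes "a \<le> b"
  shows "tau (block a (b + 1)) + tau (block a (b - 1)) = 4 * tau (block a b)"
proof -
  let ?S = "spanning_trees (block a b) (grid_on (block a b))"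
  have "finite ?S"
    by (intro finite_spanning_trees finite_simple_graph[OF finite_block simple_graph_grid_on])
  then have "card ?S = card {T \<in> ?S. {(1, b), (2, b)} \<in> T} + card {T \<in> ?S. {(1, b), (2, b)} \<notin> T}"
    by (subst card_Un_disjoint[symmetric]) (auto intro: arg_cong[where f = card])
  then show ?thesis
    using tau_block_avoiding_last_rung[OF assms] tau_block_extend[OF assms]
    unfolding tau_def by linarith
qed

text \<open>The solution 0, 1, 4, 15, ... of the recurrence; 2 + sqrt 3 and 2 - sqrt 3 are the roots
  of z^2 = 4 z - 1.\<close>

definition ladder :: "nat \<Rightarrow> real" where
  "ladder k = ((2 + sqrt 3) ^ k - (2 - sqrt 3) ^ k) / (2 * sqrt 3)"

lemma ladder_rec: "ladder (Suc (Suc k)) = 4 * ladder (Suc k) - ladder k"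
proof -
  have "(2 + sqrt 3)\<^sup>2 = 4 * (2 + sqrt 3) - 1" "(2 - sqrt 3)\<^sup>2 = 4 * (2 - sqrt 3) - 1"
    by (simp_all add: power2_eq_square algebra_simps)
  then have "(2 + sqrt 3) ^ Suc (Suc k) = 4 * (2 + sqrt 3) ^ Suc k - (2 + sqrt 3) ^ k"
    "(2 - sqrt 3) ^ Suc (Suc k) = 4 * (2 - sqrt 3) ^ Suc k - (2 - sqrt 3) ^ k"
    by (simp_all add: power2_eq_square algebra_simps)
  moreover have "(4 * A - B - (4 * C - D)) / S = 4 * ((A - C) / S) - (B - D) / S" for A B C D S :: real
    by (simp add: diff_divide_distrib right_diff_distrib)
  ultimately show ?thesis unfolding ladder_def by (simp only:)
qed

text \<open>The block has \<open>k\<close> columns beginning at an arbitrary \<open>a\<close>, since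
  the far side of a cut is a block ending at the right border; \<open>k = 0\<close> gives the empty
  block.\<close>

lemma tau_block: "real (tau (block a (a - 1 + int k))) = ladder k"
proof (induction k rule: induct_nat_012)
  case 0
  have "block a (a - 1) = {}" by (simp add: block_def)
  then show ?case by (simp add: tau_empty ladder_def)
next
  case 1
  then show ?case by (simp add: tau_block_single ladder_def)
next
  case (ge2 k)
  have "tau (block a (a - 1 + int (Suc (Suc k)))) + tau (block a (a - 1 + int k))
      = 4 * tau (block a (a - 1 + int (Suc k)))"
    using tau_block_rec[of a "a + int k"] by (simp add: algebra_simps)
  then have "real (tau (block a (a - 1 + int (Suc (Suc k))))) =
      4 * real (tau (block a (a - 1 + int (Suc k)))) - real (tau (block a (a - 1 + int k)))"
    by linarith
  then show ?case using ge2 ladder_rec[of k] by simp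
qed

section \<open>Balanced cuts of the ladder\<close>

definition half :: "int \<Rightarrow> int \<Rightarrow> int \<Rightarrow> (int \<times> int) set" where
  "half p r n = block 1 p \<union> {r} \<times> {p + 1..n - p}"

text \<open>Some edge must pass from columns up to \<open>i\<close> to later ones, and a grid edge
  that changes column is horizontal.\<close>

lemma grid_crossing:
  assumes "graph_connected S F" "F \<subseteq> grid_on S" "x \<in> S" "snd x \<le> i" "y \<in> S" "i < snd y"
  shows "\<exists>r. (r, i) \<in> S \<and> (r, i + 1) \<in> S"
proof -
  have "cut F {z. snd z \<le> i} \<noteq> {}"
    using graph_connected_cut_nonempty[OF assms(1,3) _ assms(5)] assms(4,6) by simp
  then obtain e where e: "e \<in> F" "e \<inter> {z. snd z \<le> i} \<noteq> {}" "\<not> e \<subseteq> {z. snd z \<le> i}"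
    unfolding cut_def by blast
  then obtain z w where zw: "z \<in> S" "w \<in> S" "adj z w" "snd z \<le> i" "i < snd w"
    using subsetD[OF assms(2) e(1)] by (elim grid_onE) (auto simp: adj_commute not_le)
  then have "fst w = fst z" "snd z = i" "snd w = i + 1" unfolding adj_def by linarith+
  then have "z = (fst z, i)" "w = (fst z, i + 1)" by (auto simp: prod_eq_iff)
  then show ?thesis using zw by metis
qed

lemma block_iff: "x \<in> block a b \<longleftrightarrow> (fst x = 1 \<or> fst x = 2) \<and> a \<le> snd x \<and> snd x \<le> b"
  by (cases x) (auto simp: block_def)

lemma card_block_atLeast1: "card (block 1 (int k)) = 2 * k"
  by (simp add: block_def card_cartesian_product)

text \<open>The assumption amounts to p \<le> q, in the form that arises for
  \<open>q = n - p\<close>; the total is 2 p + (q - p).\<close>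

lemma card_half:
  assumes "2 * int p \<le> q + int p"
  shows "card (block 1 (int p) \<union> {r} \<times> {int p + 1..q}) = p + nat q"
  using assms by (subst card_Un_disjoint) (auto simp: block_def card_cartesian_product)

text \<open>After the last full column, \<open>C\<close> holds at most one vertex of the next. If it
  holds none, connectedness ends \<open>C\<close> there. If it holds one, then before column
  \<open>n - p\<close> both sides still have vertices further right; being connected they both
  advance, and each can do so only in its own row.\<close>

lemma balanced_cut_shape:
  assumes tree: "T \<in> spanning_trees (block 1 (int n)) (grid_on (block 1 (int n)))"
    and cut: "cut T C = {e}" and sub: "C \<subseteq> block 1 (int n)" and card: "card C = n"
    and one: "(1, 1) \<in> C"
  shows "\<exists>p r. 2 * p \<le> n \<and> r \<in> {1, 2} \<and> (p = 0 \<or> 2 * p = n \<longrightarrow> r = 1) \<and> C = half (int p) r (int n)"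
proof -
  let ?V = "block 1 (int n)"
  let ?D = "?V - C"
  have T: "T \<subseteq> grid_on ?V" "graph_tree ?V T" using tree by (auto simp: spanning_trees_def)
  have sg: "simple_graph ?V T" by (rule simple_graph_subset[OF simple_graph_grid_on T(1)])
  obtain u v where uv: "u \<in> ?V" "v \<in> ?V" "u \<in> C" "v \<notin> C" "e = {u, v}"
    using cut_singletonE[OF sg cut] by blast
  have con: "graph_connected C (induced T C)" "graph_connected ?D (induced T ?D)"
    using tree_split[OF sg sub, of u v] cut uv T(2) by (auto simp: graph_tree_def)
  have "induced T W \<subseteq> grid_on W" if "W \<subseteq> ?V" for W
    using T(1) induced_grid_on[OF that] by (auto simp: induced_def)
  then have ind: "induced T C \<subseteq> grid_on C" "induced T ?D \<subseteq> grid_on ?D" using sub by auto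
  note crossC = grid_crossing[OF con(1) ind(1)] and crossD = grid_crossing[OF con(2) ind(2)]
  have fin: "finite C" using finite_subset[OF sub finite_block] .
  have finD: "finite ?D" using finite_block by blast
  have cardD: "card ?D = n" using card sub fin by (simp add: card_Diff_subset card_block_atLeast1)
  have n: "n > 0" using card one fin by (metis card_gt_0_iff empty_iff)
  have row: "fst x = 1 \<or> fst x = 2" if "x \<in> ?V" for x
    using that by (auto simp: block_def)
  have other_row: "fst x = 3 - t" if "x \<in> ?V" "fst x \<noteq> t" "t \<in> {1, 2}" for x t
    using that(2,3) row[OF that(1)] by auto
  define P where "P k \<longleftrightarrow> block 1 (int k) \<subseteq> C" for k
  have "P 0" by (simp add: P_def block_def)
  have "\<not> P n"
    using card_mono[OF fin, of ?V] card n by (auto simp: P_def card_block_atLeast1)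
  \<comment> \<open>The least number of leading columns not all contained in \<open>C\<close>: the
    first \<open>p = k - 1\<close> columns are full and column \<open>p + 1\<close> is not.\<close>
  define k where "k = (LEAST k. \<not> P k)"
  have k: "\<not> P k" unfolding k_def using \<open>\<not> P n\<close> by (rule LeastI)
  obtain p where kp: "k = Suc p" using k \<open>P 0\<close> by (cases k) auto
  have Pp: "P p" using not_less_Least[of p "\<lambda>k. \<not> P k"] unfolding k_def[symmetric] kp by simp
  have full: "block 1 (int p) \<subseteq> C" using Pp by (simp add: P_def)
  have "2 * p \<le> n" using card_mono[OF fin full] card by (simp add: card_block_atLeast1)
  have "\<exists>s\<in>{1, 2}. (s, int p + 1) \<notin> C"
  proof (rule ccontr)
    assume "\<not> ?thesis"
    then have "{(1, int p + 1), (2, int p + 1)} \<subseteq> C" by simp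
    moreover have "block 1 (int k) \<subseteq> block 1 (int p) \<union> {(1, int p + 1), (2, int p + 1)}"
      by (auto simp: block_def kp)
    ultimately have "block 1 (int k) \<subseteq> C" using full by blast
    then show False using k by (simp add: P_def)
  qed
  then obtain s where s: "s \<in> {1, 2}" "(s, int p + 1) \<notin> C" by blast
  define r where "r = 3 - s"
  have r: "r \<in> {1, 2}" "s = 3 - r" using s by (auto simp: r_def)
  show ?thesis
  proof (cases "(r, int p + 1) \<in> C")
    case False
    have empty: "(t, int p + 1) \<notin> C" for t
    proof
      assume t: "(t, int p + 1) \<in> C"
      then have "t = r \<or> t = s" using row[of "(t, int p + 1)"] sub s r by auto
      then show False using t s(2) False by blast
    qed
    have "C \<subseteq> block 1 (int p)"
    proof
      fix x assume x: "x \<in> C"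
      have "p \<noteq> 0"
      proof
        assume "p = 0" then show False using empty[of 1] one by simp
      qed
      have "snd x \<le> int p"
      proof (rule ccontr)
        assume "\<not> ?thesis"
        then obtain t where "(t, int p + 1) \<in> C"
          using crossC[OF one, of "int p" x] x \<open>p \<noteq> 0\<close> by auto
        then show False using empty by blast
      qed
      then show "x \<in> block 1 (int p)" using x sub by (auto simp: block_def)
    qed
    then have C: "C = block 1 (int p)" using full by blast
    then have "2 * p = n" using card by (simp add: card_block_atLeast1)
    moreover have "half (int p) 1 (int n) = block 1 (int p)"
      using \<open>2 * p = n\<close> by (auto simp: half_def)
    ultimately show ?thesis using C by (intro exI[of _ p] exI[of _ 1]) simp
  next
    case True
    have "insert (r, int p + 1) (block 1 (int p)) \<subseteq> C" using True full by blast
    from card_mono[OF fin this] have p2: "2 * p + 1 \<le> n"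
      using card by (simp add: block_def card_cartesian_product)
    have step: "\<forall>i. int p + 1 \<le> i \<and> i \<le> int p + 1 + int j \<longrightarrow> (r, i) \<in> C \<and> (s, i) \<notin> C"
      if "int p + 1 + int j \<le> int n - int p" for j
      using that
    proof (induction j)
      case 0
      then show ?case using True s(2) by (metis add.right_neutral antisym of_nat_0)
    next
      case (Suc j)
      let ?q = "int p + 1 + int j"
      have IH: "(r, i) \<in> C" "(s, i) \<notin> C" if "int p + 1 \<le> i" "i \<le> ?q" for i
        using Suc that by auto
      have q: "?q < int n - int p" using Suc.prems by simp
      obtain x where x: "x \<in> C" "?q < snd x"
      proof -
        \<comment> \<open>Counting: the part of \<open>C\<close> found so far has
          \<open>p + ?q\<close> elements, fewer than \<open>n\<close> as long as
          \<open>?q < n - p\<close>.\<close>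
        have "\<not> C \<subseteq> block 1 (int p) \<union> {r} \<times> {int p + 1..?q}"
        proof
          assume "C \<subseteq> block 1 (int p) \<union> {r} \<times> {int p + 1..?q}"
          then have "n \<le> card (block 1 (int p) \<union> {r} \<times> {int p + 1..?q})"
            unfolding card[symmetric] by (rule card_mono[rotated]) (simp add: finite_block)
          also have "\<dots> = p + nat ?q" by (rule card_half) simp
          finally show False using q by linarith
        qed
        then obtain x where x: "x \<in> C" "x \<notin> block 1 (int p) \<union> {r} \<times> {int p + 1..?q}" by blast
        have "?q < snd x"
        proof (rule ccontr)
          assume *: "\<not> ?thesis"
          have xV: "x \<in> ?V" using x(1) sub by blast
          have "x \<notin> block 1 (int p)" using x(2) by blast
          then have "int p + 1 \<le> snd x" using xV by (auto simp: block_iff)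
          moreover from this have "fst x \<noteq> r" using x(2) * by (simp add: mem_Times_iff)
          then have "fst x = s" using other_row[OF xV _ r(1)] r(2) by blast
          moreover have "snd x \<le> ?q" using * by simp
          ultimately show False using IH(2)[of "snd x"] x(1) by (metis prod.collapse)
        qed
        then show thesis using that x(1) by blast
      qed
      have "(r, ?q) \<in> C" using IH by simp
      obtain t where t: "(t, ?q) \<in> C" "(t, ?q + 1) \<in> C"
        using crossC[OF \<open>(r, ?q) \<in> C\<close> _ x(1), of ?q] x(2) by auto
      have tr: "t = r"
      proof (rule ccontr)
        assume "t \<noteq> r"
        then have "t = s" using other_row[of "(t, ?q)" r] t(1) sub r by auto
        then show False using IH(2)[of ?q] t(1) by simp
      qed
      obtain y where y: "y \<in> ?D" "?q < snd y"
      proof -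
        \<comment> \<open>The same count for the complement, which up to column \<open>?q\<close>
          occupies only row \<open>s\<close> from column \<open>p + 1\<close> on.\<close>
        have "\<not> ?D \<subseteq> {s} \<times> {int p + 1..?q}"
        proof
          assume "?D \<subseteq> {s} \<times> {int p + 1..?q}"
          then have "card ?D \<le> card ({s} \<times> {int p + 1..?q})"
            by (rule card_mono[rotated]) simp
          also have "\<dots> = Suc j" by (simp add: card_cartesian_product)
          finally show False using q cardD by linarith
        qed
        then obtain y where y: "y \<in> ?D" "y \<notin> {s} \<times> {int p + 1..?q}" by blast
        have "?q < snd y"
        proof (rule ccontr)
          assume *: "\<not> ?thesis"
          have "y \<notin> block 1 (int p)" using full y(1) by blast
          then have "int p + 1 \<le> snd y" using y(1) by (auto simp: block_iff)
          moreover from this have "fst y \<noteq> s" using y(2) * by (simp add: mem_Times_iff)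
          then have "fst y = r" using other_row[of y s] y(1) s(1) r(2) by auto
          moreover have "snd y \<le> ?q" using * by simp
          ultimately show False using IH(1)[of "snd y"] y(1) by (metis DiffD2 prod.collapse)
        qed
        then show thesis using that y(1) by blast
      qed
      have "(s, ?q) \<in> ?D" using IH(2)[of ?q] s(1) q by (simp add: block_iff)
      obtain t' where t': "(t', ?q) \<in> ?D" "(t', ?q + 1) \<in> ?D"
        using crossD[OF \<open>(s, ?q) \<in> ?D\<close> _ y(1), of ?q] y(2) by (metis order_refl snd_conv)
      have ts: "t' = s"
      proof (rule ccontr)
        assume "t' \<noteq> s"
        then have "t' = r" using other_row[of "(t', ?q)" s] t'(1) s(1) r(2) by auto
        then show False using IH(1)[of ?q] t'(1) by simp
      qed
      show ?case
      proof (intro allI impI)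
        fix i assume i: "int p + 1 \<le> i \<and> i \<le> int p + 1 + int (Suc j)"
        show "(r, i) \<in> C \<and> (s, i) \<notin> C"
        proof (cases "i \<le> ?q")
          case True then show ?thesis using IH i by blast
        next
          case False
          then have "i = ?q + 1" using i by simp
          then show ?thesis using t t' tr ts by simp
        qed
      qed
    qed
    \<comment> \<open>For \<open>j = n - 2 * p - 1\<close> the row reaches column
      \<open>n - p\<close>. The half then has \<open>n\<close> elements, leaving no room for others
      in \<open>C\<close>.\<close>
    have "half (int p) r (int n) \<subseteq> C"
      using step[of "n - 2 * p - 1"] p2 full by (auto simp: half_def of_nat_diff)
    moreover have "card (half (int p) r (int n)) = card C"
      unfolding half_def using p2 card by (subst card_half) auto
    ultimately have C: "C = half (int p) r (int n)" using fin by (metis card_subset_eq)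
    moreover have "p = 0 \<longrightarrow> r = 1" using one C by (auto simp: half_def block_def)
    ultimately show ?thesis using p2 r(1) by (intro exI[of _ p] exI[of _ r]) auto
  qed
qed

section \<open>Trees and crossing edges for a single shape\<close>

lemma half_subset: "0 \<le> p \<Longrightarrow> 2 * p \<le> n \<Longrightarrow> r \<in> {1, 2} \<Longrightarrow> half p r n \<subseteq> block 1 n"
  by (auto simp: half_def block_def)

text \<open>The complement is the half turned by 180 degrees: rows are swapped and columns
  reversed.\<close>

lemma block_minus_half:
  assumes "0 \<le> p" "2 * p \<le> n" "r \<in> {1, 2}"
  shows "block 1 n - half p r n = block (n - p + 1) n \<union> {3 - r} \<times> {p + 1..n - p}"
  using assms by (auto simp: half_def block_def)

lemma tau_row: "n \<ge> 1 \<Longrightarrow> tau ({r} \<times> {1..int n}) = 1"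
proof -
  assume n: "n \<ge> 1"
  have "tau ({(r, 1)} \<union> {r} \<times> {1 + 1..1 + int (n - 1)}) = tau {(r, 1)}"
    by (rule tau_right_tail) auto
  moreover have "{(r, 1)} \<union> {r} \<times> {1 + 1..1 + int (n - 1)} = {r} \<times> {1..int n}"
    using n by auto
  ultimately show ?thesis by (simp add: tau_singleton)
qed

text \<open>Number of spanning trees of either side of a cut; \<open>ladder 0 = 0\<close>, but for \<open>p = 0\<close> the side is a path.\<close>

definition arm :: "nat \<Rightarrow> real" where
  "arm p = (if p = 0 then 1 else ladder p)"

lemma tau_half:
  assumes "2 * p \<le> n" "n \<ge> 1" "r \<in> {1, 2}"
  shows "real (tau (half (int p) r (int n))) = arm p"
    and "real (tau (block 1 (int n) - half (int p) r (int n))) = arm p"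
proof -
  note compl = block_minus_half[of "int p" "int n" r]
  have "real (tau (half (int p) r (int n))) = arm p
    \<and> real (tau (block 1 (int n) - half (int p) r (int n))) = arm p"
  proof (cases "p = 0")
    case True
    have "half (int p) r (int n) = {r} \<times> {1..int n}"
      "block 1 (int n) - half (int p) r (int n) = {3 - r} \<times> {1..int n}"
      using True assms compl by (auto simp: half_def block_def)
    then show ?thesis using True tau_row[OF assms(2)] by (simp add: arm_def)
  next
    case False
    have "tau (block 1 (int p) \<union> {r} \<times> {int p + 1..int p + int (n - 2 * p)}) = tau (block 1 (int p))"
      by (rule tau_right_tail) (use False assms(3) in \<open>auto simp: block_def\<close>)
    moreover have "int p + int (n - 2 * p) = int n - int p" using assms(1) by simp
    ultimately have 1: "tau (half (int p) r (int n)) = tau (block 1 (int p))"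
      unfolding half_def by simp
    let ?W = "block (int n - int p + 1) (int n)" and ?q = "int n - int p + 1"
    have "tau (?W \<union> {3 - r} \<times> {?q - int (n - 2 * p)..?q - 1}) = tau ?W"
      by (rule tau_left_tail) (use False assms(3) in \<open>auto simp: block_def\<close>)
    moreover have "?q - int (n - 2 * p) = int p + 1" "?q - 1 = int n - int p" using assms(1) by simp_all
    ultimately have 2: "tau (block 1 (int n) - half (int p) r (int n)) = tau ?W"
      using compl assms by simp
    show ?thesis
      using 1 2 tau_block[of 1 p] tau_block[of ?q p] False by (simp add: arm_def)
  qed
  then show "real (tau (half (int p) r (int n))) = arm p"
    "real (tau (block 1 (int n) - half (int p) r (int n))) = arm p" by blast+
qed

text \<open>The crossing edges are the rungs in columns \<open>p + 1\<close> to \<open>n - p\<close>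
  and two horizontal edges, one leaving the full block in row \<open>3 - r\<close> and one leaving
  the end of the tail in row \<open>r\<close>. For \<open>p = 0\<close> neither horizontal edge
  exists.\<close>

lemma card_cut_half:
  assumes "2 * p \<le> n" "r \<in> {1, 2}"
  shows "card (cut (grid_on (block 1 (int n))) (half (int p) r (int n))) =
    (if p = 0 then n else n - 2 * p + 2)"
proof -
  let ?C = "half (int p) r (int n)" and ?D = "block 1 (int n) - half (int p) r (int n)"
  \<comment> \<open>Edges are counted as ordered pairs with the first end in the half; the
    orientation makes the passage to sets injective.\<close>
  let ?P = "{(x, y). x \<in> ?C \<and> y \<in> ?D \<and> adj x y}"
  let ?R = "(\<lambda>j. ((r, j), (3 - r, j))) ` {int p + 1..int n - int p}"
  let ?H = "if p = 0 then {} else {((3 - r, int p), (3 - r, int p + 1)),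
    ((r, int n - int p), (r, int n - int p + 1))}"
  have D: "?D = block (int n - int p + 1) (int n) \<union> {3 - r} \<times> {int p + 1..int n - int p}"
    using assms by (intro block_minus_half) auto
  have "cut (grid_on (block 1 (int n))) ?C = (\<lambda>(x, y). {x, y}) ` ?P"
    using half_subset[of "int p" "int n" r] assms by (subst cut_grid_on) auto
  moreover have "inj_on (\<lambda>(x, y). {x, y}) ?P"
    by (auto simp: inj_on_def doubleton_eq_iff)
  ultimately have "card (cut (grid_on (block 1 (int n))) ?C) = card ?P" by (simp add: card_image)
  also have "?P = ?R \<union> ?H"
  proof (rule equalityI; rule subsetI)
    fix z assume "z \<in> ?P"
    then obtain a b c d where z: "z = ((a, b), (c, d))" and C: "(a, b) \<in> ?C" and D': "(c, d) \<in> ?D"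
      and adj: "adj (a, b) (c, d)" by (metis (no_types, lifting) case_prodE mem_Collect_eq surj_pair)
    have 1: "(a = 1 \<or> a = 2) \<and> 1 \<le> b \<and> b \<le> int p \<or> a = r \<and> int p + 1 \<le> b \<and> b \<le> int n - int p"
      using C by (auto simp: half_def block_def)
    have 2: "(c = 1 \<or> c = 2) \<and> int n - int p + 1 \<le> d \<and> d \<le> int n \<or>
        c = 3 - r \<and> int p + 1 \<le> d \<and> d \<le> int n - int p"
      using D' unfolding D by (auto simp: block_def)
    have "\<bar>a - c\<bar> + \<bar>b - d\<bar> = 1" using adj by (simp add: adj_def)
    then have 3: "a = c \<and> (d = b + 1 \<or> b = d + 1) \<or> b = d \<and> a \<noteq> c" by arith
    have 4: "r = 1 \<or> r = 2" "2 * int p \<le> int n" using assms by auto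
    have "a = r \<and> c = 3 - r \<and> b = d \<and> int p + 1 \<le> b \<and> b \<le> int n - int p \<or>
      int p \<ge> 1 \<and> (a = 3 - r \<and> c = 3 - r \<and> b = int p \<and> d = int p + 1 \<or>
        a = r \<and> c = r \<and> b = int n - int p \<and> d = int n - int p + 1)"
      using 1
    proof
      assume C: "(a = 1 \<or> a = 2) \<and> 1 \<le> b \<and> b \<le> int p"
      then have "b < d" using 2 4(2) by linarith
      then have d: "a = c" "d = b + 1" using 3 by auto
      then have "b = int p" using C 2 4(2) by linarith
      moreover have "a = 3 - r \<or> a = r" using C 4(1) by auto
      \<comment> \<open>The right neighbour of the block in row \<open>r\<close> belongs to the
        tail, unless the tail is empty; then the pair is the second element of
        \<open>?H\<close>.\<close>
      moreover have "2 * int p = int n" if "c = r" using 2 4 C d that by auto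
      ultimately show ?thesis using C d by auto
    next
      assume C: "a = r \<and> int p + 1 \<le> b \<and> b \<le> int n - int p"
      show ?thesis using 2
      proof
        assume D: "(c = 1 \<or> c = 2) \<and> int n - int p + 1 \<le> d \<and> d \<le> int n"
        then have "b < d" using C by linarith
        then have "a = c" "d = b + 1" using 3 by auto
        then show ?thesis using C D by linarith
      next
        assume D: "c = 3 - r \<and> int p + 1 \<le> d \<and> d \<le> int n - int p"
        then have "a \<noteq> c" using C 4(1) by auto
        then show ?thesis using 3 C D by auto
      qed
    qed
    then show "z \<in> ?R \<union> ?H" unfolding z by auto
  next
    fix z assume "z \<in> ?R \<union> ?H"
    then show "z \<in> ?P" using assms unfolding D
      by (auto simp: half_def block_def adj_def split: if_splits)
  qed
  also have "card (?R \<union> ?H) = card ?R + card ?H"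
    using assms(2) by (intro card_Un_disjoint) auto
  also have "card ?R = n - 2 * p"
    by (subst card_image) (auto simp: inj_on_def)
  also have "card ?H = (if p = 0 then 0 else 2)" using assms(2) by auto
  finally show ?thesis by simp
qed

text \<open>The row is fixed to 1 in two cases: for \<open>p = 0\<close> because the corner must
  belong to the half, and for \<open>2 * p = n\<close> because the tail is empty and both rows give
  the same set.\<close>

definition shapes :: "nat \<Rightarrow> (nat \<times> int) set" where
  "shapes n = (SIGMA p:{..n div 2}. if p = 0 \<or> 2 * p = n then {1} else {1, 2})"

lemma shapes_iff:
  "(p, r) \<in> shapes n \<longleftrightarrow> 2 * p \<le> n \<and> r \<in> {1, 2} \<and> (p = 0 \<or> 2 * p = n \<longrightarrow> r = 1)"
  by (auto simp: shapes_def)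

text \<open>Column \<open>p + 1\<close> is the first that is not full, which determines
  \<open>p\<close>; its vertex in the half, if there is one, determines \<open>r\<close>.\<close>

lemma half_inj:
  assumes "(p, r) \<in> shapes n" "(p', r') \<in> shapes n" "n \<ge> 1"
    and "half (int p) r (int n) = half (int p') r' (int n)"
  shows "p = p' \<and> r = r'"
proof -
  have le: "k' \<le> k" if "(k, s) \<in> shapes n" "half (int k) s (int n) = half (int k') s' (int n)" for k k' s s'
  proof (rule ccontr)
    assume "\<not> k' \<le> k"
    then have "(3 - s, int k + 1) \<in> half (int k') s' (int n)"
      using that(1) by (auto simp: half_def block_def shapes_iff)
    moreover have "(3 - s, int k + 1) \<notin> half (int k) s (int n)"
      using that(1) by (auto simp: half_def block_def shapes_iff)
    ultimately show False using that(2) by simp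
  qed
  have "p = p'" using le[OF assms(1,4)] le[OF assms(2) assms(4)[symmetric]] by simp
  moreover have "r = r'"
  proof (cases "2 * p = n")
    case True then show ?thesis using assms(1,2) \<open>p = p'\<close> by (simp add: shapes_iff)
  next
    case False
    then have "(r, int p + 1) \<in> half (int p) r (int n)"
      using assms(1) by (auto simp: half_def shapes_iff)
    then have "(r, int p + 1) \<in> half (int p) r' (int n)" using assms(4) \<open>p = p'\<close> by simp
    then show ?thesis by (auto simp: half_def block_def)
  qed
  ultimately show ?thesis by simp
qed

lemma shapes_half:
  assumes "(p, r) \<in> shapes n" "n \<ge> 1"
  shows "half (int p) r (int n) \<subseteq> block 1 (int n)" "(1, 1) \<in> half (int p) r (int n)"
    "card (half (int p) r (int n)) = n"
proof -
  show "half (int p) r (int n) \<subseteq> block 1 (int n)"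
    using assms by (intro half_subset) (auto simp: shapes_iff)
  show "(1, 1) \<in> half (int p) r (int n)"
    using assms by (cases "p = 0") (auto simp: half_def block_def shapes_iff)
  show "card (half (int p) r (int n)) = n"
    unfolding half_def using assms by (subst card_half) (auto simp: shapes_iff)
qed

text \<open>Every balanced tree is crossed once by exactly one shape, and a shape accounts for
  \<open>arm p\<close> trees on each side times its crossing edges. Summing over \<open>r\<close>
  produces the weight 1 or 2.\<close>

lemma num_balanced_eq:
  assumes "n \<ge> 1"
  shows "real (num_balanced_spanning_trees n) =
    (\<Sum>p\<le>n div 2. (if p = 0 \<or> 2 * p = n then 1 else 2) *
      ((arm p)\<^sup>2 * (if p = 0 then real n else real n - 2 * real p + 2)))"
proof -
  let ?V = "block 1 (int n)"
  let ?E = "grid_on ?V"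
  let ?S = "spanning_trees ?V ?E"
  let ?H = "\<lambda>(p, r). half (int p) r (int n)"
  let ?B = "\<lambda>i. {T \<in> ?S. \<exists>e. cut T (?H i) = {e}}"
  have tree: "simple_graph ?V T \<and> graph_tree ?V T" if "T \<in> ?S" for T
    using that simple_graph_subset[OF simple_graph_grid_on] by (auto simp: spanning_trees_def)
  have balanced_iff: "balanced_tree ?V T \<longleftrightarrow> (\<exists>C\<subseteq>?V. 2 * card C = card ?V \<and> (\<exists>e. cut T C = {e}))"
    if "T \<in> ?S" for T
    using balanced_tree_iff_cut[OF finite_block] tree[OF that] by metis
  have fin: "finite ?S"
    by (intro finite_spanning_trees finite_simple_graph[OF finite_block simple_graph_grid_on])
  have finI: "finite (shapes n)" by (auto simp: shapes_def)
  have iff: "balanced_tree ?V T \<longleftrightarrow> (\<exists>i\<in>shapes n. \<exists>e. cut T (?H i) = {e})" if T: "T \<in> ?S" for T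
  proof
    assume "balanced_tree ?V T"
    then obtain C e where C: "C \<subseteq> ?V" "2 * card C = card ?V" "cut T C = {e}"
      unfolding balanced_iff[OF T] by blast
    \<comment> \<open>Passing to the complement, which has the same size and the same cut, brings
      the corner into the half.\<close>
    obtain C' where C': "C' \<subseteq> ?V" "2 * card C' = card ?V" "cut T C' = {e}" "(1, 1) \<in> C'"
    proof (cases "(1, 1) \<in> C")
      case True then show thesis using that C by blast
    next
      case False
      have "cut T (?V - C) = {e}" using cut_Diff tree[OF T] C(3) by metis
      moreover have "2 * card (?V - C) = card ?V"
        using C by (simp add: card_Diff_subset finite_subset[OF C(1) finite_block])
      moreover have "(1, 1) \<in> ?V - C" using False assms by (simp add: block_iff)
      ultimately show thesis using that[of "?V - C"] by blast
    qed
    have "card C' = n" using C'(2) by (simp add: card_block_atLeast1)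
    from balanced_cut_shape[OF T C'(3,1) this C'(4)] obtain p r
      where "(p, r) \<in> shapes n" "C' = half (int p) r (int n)" unfolding shapes_iff by blast
    then show "\<exists>i\<in>shapes n. \<exists>e. cut T (?H i) = {e}" using C'(3) by (intro bexI[of _ "(p, r)"]) auto
  next
    assume "\<exists>i\<in>shapes n. \<exists>e. cut T (?H i) = {e}"
    then obtain p r e where pr: "(p, r) \<in> shapes n" "cut T (half (int p) r (int n)) = {e}" by auto
    then show "balanced_tree ?V T"
      unfolding balanced_iff[OF T] using shapes_half[OF pr(1) assms]
      by (intro exI[of _ "half (int p) r (int n)"]) (simp add: card_block_atLeast1)
  qed
  have "{T \<in> ?S. balanced_tree ?V T} = {T \<in> ?S. \<exists>i\<in>shapes n. \<exists>e. cut T (?H i) = {e}}"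
    by (intro Collect_cong conj_cong refl) (erule iff)
  also have "\<dots> = (\<Union>i\<in>shapes n. ?B i)" by blast
  finally have "num_balanced_spanning_trees n = card (\<Union>i\<in>shapes n. ?B i)"
    unfolding num_balanced_spanning_trees_def grid_edges_eq grid_verts_eq by simp
  also have "\<dots> = (\<Sum>i\<in>shapes n. card (?B i))"
  proof (rule card_UN_disjoint[OF finI])
    show "\<forall>i\<in>shapes n. finite (?B i)" using fin by simp
    show "\<forall>i\<in>shapes n. \<forall>j\<in>shapes n. i \<noteq> j \<longrightarrow> ?B i \<inter> ?B j = {}"
    proof (intro ballI impI)
      fix i j assume ij: "i \<in> shapes n" "j \<in> shapes n" "i \<noteq> j"
      obtain p r p' r' where [simp]: "i = (p, r)" "j = (p', r')" by (cases i; cases j)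
      note i = shapes_half[OF ij(1)[simplified] assms] and j = shapes_half[OF ij(2)[simplified] assms]
      show "?B i \<inter> ?B j = {}"
      proof (rule ccontr)
        assume "?B i \<inter> ?B j \<noteq> {}"
        then obtain T e e' where T: "T \<in> ?S" "cut T (half (int p) r (int n)) = {e}"
          "cut T (half (int p') r' (int n)) = {e'}" by auto
        have "half (int p) r (int n) = half (int p') r' (int n)"
          by (rule tree_card_cut_unique[OF finite_block, of _ _ T _ e _ e' "(1, 1)"])
            (use tree[OF T(1)] T i j in \<open>auto simp: card_block_atLeast1\<close>)
        then show False using half_inj ij assms by auto
      qed
    qed
  qed
  finally have "real (num_balanced_spanning_trees n) = (\<Sum>i\<in>shapes n. real (card (?B i)))" by simp
  also have "\<dots> = (\<Sum>(p, r)\<in>shapes n. (arm p)\<^sup>2 * (if p = 0 then real n else real n - 2 * real p + 2))"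
  proof (rule sum.cong[OF refl])
    fix i assume i: "i \<in> shapes n"
    obtain p r where [simp]: "i = (p, r)" by (cases i)
    note sh = i[simplified, unfolded shapes_iff]
    have "real (card (?B i)) = real (tau (half (int p) r (int n))) *
        real (tau (?V - half (int p) r (int n))) * real (card (cut ?E (half (int p) r (int n))))"
      using card_trees_single_cut[OF simple_graph_grid_on shapes_half(1)[OF i[simplified] assms]]
        shapes_half(1)[OF i[simplified] assms]
      by (simp add: tau_def induced_grid_on)
    also have "\<dots> = (arm p)\<^sup>2 * real (if p = 0 then n else n - 2 * p + 2)"
      using tau_half[of p n r] card_cut_half[of p n r] sh assms by (simp add: power2_eq_square)
    finally show "real (card (?B i)) = (case i of (p, r) \<Rightarrow>
        (arm p)\<^sup>2 * (if p = 0 then real n else real n - 2 * real p + 2))"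
      using sh by (simp add: of_nat_diff)
  qed
  also have "\<dots> = (\<Sum>p\<le>n div 2. \<Sum>r\<in>(if p = 0 \<or> 2 * p = n then {1::int} else {1, 2}).
      (arm p)\<^sup>2 * (if p = 0 then real n else real n - 2 * real p + 2))"
    unfolding shapes_def by (rule sum.Sigma[symmetric]) auto
  also have "\<dots> = (\<Sum>p\<le>n div 2. (if p = 0 \<or> 2 * p = n then 1 else 2) *
      ((arm p)\<^sup>2 * (if p = 0 then real n else real n - 2 * real p + 2)))"
    by (rule sum.cong) auto
  finally show ?thesis .
qed

lemma num_spanning_trees_eq: "real (num_spanning_trees n) = ladder n"
  using tau_block[of 1 n] by (simp add: num_spanning_trees_def tau_def grid_edges_eq grid_verts_eq)

section \<open>Asymptotics\<close>

text \<open>The squares of 2 + sqrt 3 and 2 - sqrt 3 are 7 + 4 sqrt 3 and 7 - 4 sqrt 3; their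
  product is 1, whence the constant -2.\<close>

lemma ladder_square: "(ladder p)\<^sup>2 = ((7 + 4 * sqrt 3) ^ p + (7 - 4 * sqrt 3) ^ p - 2) / 12"
proof -
  define s where "s = sqrt 3"
  have s2: "s * s = 3" by (simp add: s_def)
  have "(2 + s) ^ p * (2 - s) ^ p = 1"
    using s2 by (simp add: power_mult_distrib[symmetric] algebra_simps)
  moreover have "((2 + s) ^ p)\<^sup>2 = (7 + 4 * s) ^ p" "((2 - s) ^ p)\<^sup>2 = (7 - 4 * s) ^ p"
    using s2 by (simp_all add: power2_eq_square power_mult_distrib[symmetric] algebra_simps)
  ultimately show ?thesis
    unfolding ladder_def s_def[symmetric]
    using s2 by (simp add: power_divide power_mult_distrib power2_diff power2_eq_square[of s])
qed

text \<open>With q = 7 + 4 sqrt 3, the leading coefficient of the geometric sum is q / (q - 1) = (3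
  + 2 sqrt 3) / 6. The weighted sum is the sum of the partial sums, so this factor is squared, and
  (q - 1)^2 = 12 q turns it into q / 12. The conjugate terms are analogous.\<close>

lemma ladder_square_sums:
  "(\<Sum>p\<le>m. (ladder p)\<^sup>2) =
    ((3 + 2 * sqrt 3) / 6 * (7 + 4 * sqrt 3) ^ m + (3 - 2 * sqrt 3) / 6 * (7 - 4 * sqrt 3) ^ m
      - 2 * real m - 1) / 12"
  "(\<Sum>p\<le>m. (real m - real p + 1) * (ladder p)\<^sup>2) =
    ((7 + 4 * sqrt 3) / 12 * (7 + 4 * sqrt 3) ^ m + (7 - 4 * sqrt 3) / 12 * (7 - 4 * sqrt 3) ^ m
      - (real m)\<^sup>2 - 2 * real m - 7 / 6) / 12"
proof -
  define s where "s = sqrt 3"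
  have s2: "s * s = 3" by (simp add: s_def)
  have s3: "s * (s * x) = 3 * x" for x using s2 by (simp add: mult.assoc[symmetric])
  have sq: "(ladder p)\<^sup>2 = ((7 + 4 * s) ^ p + (7 - 4 * s) ^ p - 2) / 12" for p
    by (simp add: ladder_square s_def)
  have B: "(\<Sum>p\<le>m. (ladder p)\<^sup>2) =
    ((3 + 2 * s) / 6 * (7 + 4 * s) ^ m + (3 - 2 * s) / 6 * (7 - 4 * s) ^ m - 2 * real m - 1) / 12" for m
  proof (induction m)
    case 0
    show ?case by (simp add: sq field_simps)
  next
    case (Suc m)
    show ?case
      unfolding sum.atMost_Suc Suc sq[of "Suc m"]
      using s2 by (simp add: field_simps s3)
  qed
  have A: "(\<Sum>p\<le>m. (real m - real p + 1) * (ladder p)\<^sup>2) =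
    ((7 + 4 * s) / 12 * (7 + 4 * s) ^ m + (7 - 4 * s) / 12 * (7 - 4 * s) ^ m
      - (real m)\<^sup>2 - 2 * real m - 7 / 6) / 12" for m
  proof (induction m)
    case 0
    show ?case by (simp add: sq field_simps)
  next
    case (Suc m)
    \<comment> \<open>Raising \<open>m\<close> by one raises every weight by one and adds the term
      \<open>p = Suc m\<close> with weight 1; the increment is the plain sum.\<close>
    have "(\<Sum>p\<le>Suc m. (real (Suc m) - real p + 1) * (ladder p)\<^sup>2)
        = (\<Sum>p\<le>m. (real m - real p + 1) * (ladder p)\<^sup>2) + (\<Sum>p\<le>Suc m. (ladder p)\<^sup>2)"
      by (simp add: sum.distrib[symmetric] algebra_simps)
    also have "\<dots> = ((7 + 4 * s) / 12 * (7 + 4 * s) ^ Suc m + (7 - 4 * s) / 12 * (7 - 4 * s) ^ Suc m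
      - (real (Suc m))\<^sup>2 - 2 * real (Suc m) - 7 / 6) / 12"
      unfolding Suc B using s2 by (simp add: field_simps s3 power2_eq_square)
    finally show ?case .
  qed
  show "(\<Sum>p\<le>m. (ladder p)\<^sup>2) =
    ((3 + 2 * sqrt 3) / 6 * (7 + 4 * sqrt 3) ^ m + (3 - 2 * sqrt 3) / 6 * (7 - 4 * sqrt 3) ^ m
      - 2 * real m - 1) / 12"
    using B by (simp add: s_def)
  show "(\<Sum>p\<le>m. (real m - real p + 1) * (ladder p)\<^sup>2) =
    ((7 + 4 * sqrt 3) / 12 * (7 + 4 * sqrt 3) ^ m + (7 - 4 * sqrt 3) / 12 * (7 - 4 * sqrt 3) ^ m
      - (real m)\<^sup>2 - 2 * real m - 7 / 6) / 12"
    using A by (simp add: s_def)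
qed

section \<open>The balanced count for odd and even length\<close>

lemma ladder_0: "ladder 0 = 0"
  by (simp add: ladder_def)

text \<open>Here \<open>n - 2 p + 2\<close> is 2 (m - p + 1) + 1, and the weight is 2 for all
  positive \<open>p\<close>. The term \<open>p = 0\<close> can be included in the sums because
  \<open>ladder 0 = 0\<close>, and contributes only \<open>n\<close>.\<close>

lemma num_balanced_odd:
  "real (num_balanced_spanning_trees (2 * m + 1)) = 2 * real m + 1
    + 4 * (\<Sum>p\<le>m. (real m - real p + 1) * (ladder p)\<^sup>2) + 2 * (\<Sum>p\<le>m. (ladder p)\<^sup>2)"
proof -
  have "real (num_balanced_spanning_trees (2 * m + 1)) =
    (\<Sum>p\<le>m. (if p = 0 then 2 * real m + 1 else 0)
      + 4 * ((real m - real p + 1) * (ladder p)\<^sup>2) + 2 * (ladder p)\<^sup>2)"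
  proof -
    have "2 * p \<noteq> 2 * m + 1" for p by presburger
    then show ?thesis
      by (subst num_balanced_eq, simp)
        (rule sum.cong, auto simp: arm_def ladder_0 algebra_simps)
  qed
  also have "\<dots> = 2 * real m + 1 + 4 * (\<Sum>p\<le>m. (real m - real p + 1) * (ladder p)\<^sup>2)
      + 2 * (\<Sum>p\<le>m. (ladder p)\<^sup>2)"
    by (simp add: sum.distrib sum_distrib_left)
  finally show ?thesis .
qed

text \<open>Here \<open>n - 2 p + 2\<close> is 2 (m - p + 1). The subtracted square corrects the
  middle term \<open>p = m\<close>, which has weight 1 instead of 2.\<close>

lemma num_balanced_even:
  assumes "m \<ge> 1"
  shows "real (num_balanced_spanning_trees (2 * m)) = 2 * real m
    + 4 * (\<Sum>p\<le>m. (real m - real p + 1) * (ladder p)\<^sup>2) - 2 * (ladder m)\<^sup>2"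
proof -
  have "real (num_balanced_spanning_trees (2 * m)) =
    (\<Sum>p\<le>m. (if p = 0 then 2 * real m else 0)
      + 4 * ((real m - real p + 1) * (ladder p)\<^sup>2) - (if p = m then 2 * (ladder m)\<^sup>2 else 0))"
    using assms
    by (subst num_balanced_eq, simp)
      (rule sum.cong, auto simp: arm_def ladder_0 algebra_simps)
  also have "\<dots> = 2 * real m + 4 * (\<Sum>p\<le>m. (real m - real p + 1) * (ladder p)\<^sup>2) - 2 * (ladder m)\<^sup>2"
    by (simp add: sum.distrib sum_subtractf sum_distrib_left)
  finally show ?thesis .
qed

theorem theorem1:
  shows "((\<lambda>m. real (num_balanced_spanning_trees (2 * m + 1)) / real (num_spanning_trees (2 * m + 1)))
            \<longlonglongrightarrow> (3 + sqrt 3) / 9)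
       \<and> ((\<lambda>m. real (num_balanced_spanning_trees (2 * m)) / real (num_spanning_trees (2 * m)))
            \<longlonglongrightarrow> (1 + 4 * sqrt 3) / (6 * sqrt 3))"
proof -
  define s where "s = sqrt 3"
  have s2: "s * s = 3" and s_pos: "s > 0" by (simp_all add: s_def)
  have s_bounds: "1 < s" "s < 2" unfolding s_def by (simp_all add: real_less_lsqrt)
  have s3: "s * (s * y) = 3 * y" for y using s2 by (simp add: mult.assoc[symmetric])
  define x where "x = 2 - s"
  have x: "0 < x" "x < 1" using s_bounds by (simp_all add: x_def)
  \<comment> \<open>The inverse of the dominant power \<open>(7 + 4 * s) ^ m\<close>; numerators and denominators are multiplied by it.\<close>
  define u where "u m = (7 - 4 * s) ^ m" for m :: nat
  have c: "7 - 4 * s = x\<^sup>2" using s2 by (simp add: x_def power2_eq_square algebra_simps)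
  \<comment> \<open>Splitting \<open>u m\<close> into two factors lets each of them absorb one
    factor \<open>real m\<close>, enough for the quadratic terms below.\<close>
  have ux: "u m = x ^ m * x ^ m" for m
    unfolding u_def c by (simp add: power2_eq_square power_mult_distrib)
  have xm: "(\<lambda>m. x ^ m) \<longlonglongrightarrow> 0" using x by (intro LIMSEQ_power_zero) simp
  have mxm: "(\<lambda>m. real m * x ^ m) \<longlonglongrightarrow> 0" using powser_times_n_limit_0[of x] x by simp
  have u0: "u \<longlonglongrightarrow> 0" using tendsto_mult[OF xm xm] by (simp add: ux[abs_def])
  have u1: "(\<lambda>m. real m * u m) \<longlonglongrightarrow> 0"
    using tendsto_mult[OF mxm xm] by (simp add: ux mult.assoc)
  have u2: "(\<lambda>m. (real m)\<^sup>2 * u m) \<longlonglongrightarrow> 0"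
    using tendsto_mult[OF mxm mxm] by (simp add: ux power2_eq_square mult_ac)
  have u_pos: "u m > 0" for m using x by (simp add: ux)
  have vu: "(7 + 4 * s) ^ m * u m = 1" for m
  proof -
    have "(7 + 4 * s) * (7 - 4 * s) = 49 - 16 * (s * s)" by (simp add: algebra_simps)
    then show ?thesis using s2 by (simp add: u_def power_mult_distrib[symmetric])
  qed
  have pow2: "(2 + s) ^ (2 * m) = (7 + 4 * s) ^ m" "(2 - s) ^ (2 * m) = u m" for m
  proof -
    have "(2 + s)\<^sup>2 = 7 + 4 * s" "(2 - s)\<^sup>2 = 7 - 4 * s"
      using s2 by (simp_all add: power2_eq_square algebra_simps)
    then show "(2 + s) ^ (2 * m) = (7 + 4 * s) ^ m" "(2 - s) ^ (2 * m) = u m"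
      by (simp_all only: u_def power_mult)
  qed
  have ratio: "a / b = a * u m / (b * u m)" for a b m using u_pos[of m] by simp
  have sq: "(ladder m)\<^sup>2 * u m = (1 + u m * u m - 2 * u m) / 12" for m
    unfolding ladder_square s_def[symmetric] u_def[symmetric] using vu[of m] by (simp add: algebra_simps)
  have even_den: "ladder (2 * m) * u m = (1 - u m * u m) / (2 * s)" for m
    unfolding ladder_def s_def[symmetric] pow2 using vu[of m] by (simp add: left_diff_distrib)
  have odd_den: "ladder (2 * m + 1) * u m = ((2 + s) - (2 - s) * (u m * u m)) / (2 * s)" for m
    unfolding ladder_def s_def[symmetric] power_add pow2 using vu[of m] by (simp add: algebra_simps)
  have B: "(\<Sum>p\<le>m. (ladder p)\<^sup>2) * u m =
      ((3 + 2 * s) / 6 + (3 - 2 * s) / 6 * (u m * u m) - 2 * (real m * u m) - u m) / 12" for m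
  proof -
    have "(\<Sum>p\<le>m. (ladder p)\<^sup>2) * u m = ((3 + 2 * s) / 6 * ((7 + 4 * s) ^ m * u m)
        + (3 - 2 * s) / 6 * (u m * u m) - 2 * (real m * u m) - u m) / 12"
      unfolding ladder_square_sums s_def[symmetric] u_def[symmetric] by (simp add: algebra_simps)
    then show ?thesis by (simp add: vu)
  qed
  have A: "(\<Sum>p\<le>m. (real m - real p + 1) * (ladder p)\<^sup>2) * u m =
      ((7 + 4 * s) / 12 + (7 - 4 * s) / 12 * (u m * u m) - (real m)\<^sup>2 * u m - 2 * (real m * u m) - 7 / 6 * u m) / 12"
    for m
  proof -
    have "(\<Sum>p\<le>m. (real m - real p + 1) * (ladder p)\<^sup>2) * u m =
      ((7 + 4 * s) / 12 * ((7 + 4 * s) ^ m * u m) + (7 - 4 * s) / 12 * (u m * u m)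
        - (real m)\<^sup>2 * u m - 2 * (real m * u m) - 7 / 6 * u m) / 12"
      unfolding ladder_square_sums s_def[symmetric] u_def[symmetric] by (simp add: algebra_simps)
    then show ?thesis by (simp add: vu)
  qed
  \<comment> \<open>After scaling by \<open>u m\<close> the dominant power becomes 1 and all other
    terms vanish, so only the leading coefficient of the closed form remains.\<close>
  have Alim: "(\<lambda>m. (\<Sum>p\<le>m. (real m - real p + 1) * (ladder p)\<^sup>2) * u m) \<longlonglongrightarrow> (7 + 4 * s) / 144"
    unfolding A by (rule tendsto_eq_intros u0 u1 u2 refl | simp)+
  have Blim: "(\<lambda>m. (\<Sum>p\<le>m. (ladder p)\<^sup>2) * u m) \<longlonglongrightarrow> (3 + 2 * s) / 72"
    unfolding B by (rule tendsto_eq_intros u0 u1 u2 refl | simp)+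
  have Llim: "(\<lambda>m. (ladder m)\<^sup>2 * u m) \<longlonglongrightarrow> 1 / 12"
    unfolding sq by (rule tendsto_eq_intros u0 refl | simp)+
  have odd_ratio: "real (num_balanced_spanning_trees (2 * m + 1)) / real (num_spanning_trees (2 * m + 1)) =
      (2 * (real m * u m) + u m + 4 * ((\<Sum>p\<le>m. (real m - real p + 1) * (ladder p)\<^sup>2) * u m)
        + 2 * ((\<Sum>p\<le>m. (ladder p)\<^sup>2) * u m)) / (((2 + s) - (2 - s) * (u m * u m)) / (2 * s))" for m
    unfolding odd_den[symmetric] num_balanced_odd num_spanning_trees_eq
    by (subst ratio[of _ _ m]) (simp add: algebra_simps)
  have "(\<lambda>m. real (num_balanced_spanning_trees (2 * m + 1)) / real (num_spanning_trees (2 * m + 1)))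
      \<longlonglongrightarrow> (2 * 0 + 0 + 4 * ((7 + 4 * s) / 144) + 2 * ((3 + 2 * s) / 72)) / (((2 + s) - (2 - s) * (0 * 0)) / (2 * s))"
    unfolding odd_ratio by (intro tendsto_intros Alim Blim u0 u1) (use s_pos in simp_all)
  \<comment> \<open>The value is (9 + 5 s) / (9 (2 + s)), and (3 + s) (2 + s) = 9 + 5 s.\<close>
  also have "(2 * 0 + 0 + 4 * ((7 + 4 * s) / 144) + 2 * ((3 + 2 * s) / 72)) / (((2 + s) - (2 - s) * (0 * 0)) / (2 * s))
      = (3 + s) / 9"
    using s_pos s2 by (simp add: field_simps)
  finally have odd: "(\<lambda>m. real (num_balanced_spanning_trees (2 * m + 1)) / real (num_spanning_trees (2 * m + 1)))
      \<longlonglongrightarrow> (3 + s) / 9" .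
  \<comment> \<open>Valid only from \<open>m = 1\<close> on, so the limit is transferred by eventual
    equality.\<close>
  have even_ratio: "real (num_balanced_spanning_trees (2 * m)) / real (num_spanning_trees (2 * m)) =
      (2 * (real m * u m) + 4 * ((\<Sum>p\<le>m. (real m - real p + 1) * (ladder p)\<^sup>2) * u m)
        - 2 * ((ladder m)\<^sup>2 * u m)) / ((1 - u m * u m) / (2 * s))" if "m \<ge> 1" for m
    unfolding even_den[symmetric] num_balanced_even[OF that] num_spanning_trees_eq
    by (subst ratio[of _ _ m]) (simp add: algebra_simps)
  have "(\<lambda>m. (2 * (real m * u m) + 4 * ((\<Sum>p\<le>m. (real m - real p + 1) * (ladder p)\<^sup>2) * u m)
        - 2 * ((ladder m)\<^sup>2 * u m)) / ((1 - u m * u m) / (2 * s)))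
      \<longlonglongrightarrow> (2 * 0 + 4 * ((7 + 4 * s) / 144) - 2 * (1 / 12)) / ((1 - 0 * 0) / (2 * s))"
    by (intro tendsto_intros Alim Llim u0 u1) (use s_pos in simp_all)
  also have "(2 * 0 + 4 * ((7 + 4 * s) / 144) - 2 * (1 / 12)) / ((1 - 0 * 0) / (2 * s)) = (1 + 4 * s) / (6 * s)"
    using s_pos s2 by (simp add: field_simps s3)
  finally have "(\<lambda>m. real (num_balanced_spanning_trees (2 * m)) / real (num_spanning_trees (2 * m)))
      \<longlonglongrightarrow> (1 + 4 * s) / (6 * s)"
    by (rule Lim_transform_eventually)
      (use even_ratio in \<open>auto intro!: eventually_mono[OF eventually_ge_at_top[of 1]]\<close>)
  then show ?thesis using odd unfolding s_def by blast
qed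

end
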